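(* Let $(\mathcal U,\sigma,D)$ be a saturated model of $DCFA$ and let $n\ge 1$. No infinite definable subgroup of $\mathbb G_a^n(\mathcal U)$ is $1$-based.
   Context: All fields have characteristic $0$. A difference-differential field is a field with a derivation $D$ and a field automorphism $\sigma$ commuting with $D$; $\mathcal L_{\sigma,D}=\{0,1,+,-,\cdot,\sigma,D\}$. $DCFA$ is the model companion of the theory of difference-differential fields of characteristic $0$ (its models are the existentially closed ones). $\mathbb G_a$ is the additive group. A set $S$ definable over $A$ is $1$-based if for all $m,k\in\mathbb N$ and $a\in S^m$, $b\in S^k$, $a$ and $b$ are independent over $\mathrm{acl}(Aa)\cap\mathrm{acl}(Ab)$. Here $\mathrm{acl}(A)$ is the field-theoretic algebraic closure of the difference-differential field generated by $A$, and $A$ is independent from $B$ over $C$ iff $\mathrm{acl}(AC)$ and $\mathrm{acl}(BC)$ are linearly disjoint over $\mathrm{acl}(C)$ (non-forking). *)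

theory Defs
  imports "HOL-Algebra.Algebra" "HOL-Library.Equipollence"
begin

section \<open>Difference-differential fields\<close>

record 'a dd_ring = "'a ring" +
  sig :: "'a \<Rightarrow> 'a"
  der :: "'a \<Rightarrow> 'a"

locale dd_field = field K for K :: "'a dd_ring" (structure) +
  assumes char_0: "\<And>k :: nat. k > 0 \<Longrightarrow> [k] \<cdot> \<one> \<noteq> \<zero>"
    and sig_aut: "sig K \<in> ring_iso K K"
    and der_closed: "\<And>x. x \<in> carrier K \<Longrightarrow> der K x \<in> carrier K"
    and der_add: "\<And>x y. \<lbrakk>x \<in> carrier K; y \<in> carrier K\<rbrakk> \<Longrightarrow>
      der K (x \<oplus> y) = der K x \<oplus> der K y"
    and der_mult: "\<And>x y. \<lbrakk>x \<in> carrier K; y \<in> carrier K\<rbrakk> \<Longrightarrow>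
      der K (x \<otimes> y) = (der K x \<otimes> y) \<oplus> (x \<otimes> der K y)"
    and sig_der: "\<And>x. x \<in> carrier K \<Longrightarrow> sig K (der K x) = der K (sig K x)"

definition dd_hom :: "'a dd_ring \<Rightarrow> 'b dd_ring \<Rightarrow> ('a \<Rightarrow> 'b) set" where
  "dd_hom K L = {f \<in> ring_hom K L.
     \<forall>x \<in> carrier K. f (sig K x) = sig L (f x) \<and> f (der K x) = der L (f x)}"

section \<open>First-order formulas in the language of difference-differential fields\<close>

text \<open>Variables are named by natural numbers; the constants \<open>Const c\<close> are parameters.\<close>

datatype (tm_consts: 'a) dd_tm =
    Var nat
  | Const 'a
  | Zero
  | One
  | Add "'a dd_tm" "'a dd_tm"
  | Sub "'a dd_tm" "'a dd_tm"
  | Mul "'a dd_tm" "'a dd_tm"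
  | Sig "'a dd_tm"
  | Der "'a dd_tm"

datatype (fm_consts: 'a) dd_fm =
    Eq "'a dd_tm" "'a dd_tm"
  | Neg "'a dd_fm"
  | Conj "'a dd_fm" "'a dd_fm"
  | Ex nat "'a dd_fm"

primrec tm_val :: "'a dd_ring \<Rightarrow> (nat \<Rightarrow> 'a) \<Rightarrow> 'a dd_tm \<Rightarrow> 'a" where
  "tm_val K v (Var i) = v i"
| "tm_val K v (Const c) = c"
| "tm_val K v Zero = \<zero>\<^bsub>K\<^esub>"
| "tm_val K v One = \<one>\<^bsub>K\<^esub>"
| "tm_val K v (Add s t) = tm_val K v s \<oplus>\<^bsub>K\<^esub> tm_val K v t"
| "tm_val K v (Sub s t) = tm_val K v s \<ominus>\<^bsub>K\<^esub> tm_val K v t"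
| "tm_val K v (Mul s t) = tm_val K v s \<otimes>\<^bsub>K\<^esub> tm_val K v t"
| "tm_val K v (Sig t) = sig K (tm_val K v t)"
| "tm_val K v (Der t) = der K (tm_val K v t)"

primrec sat :: "'a dd_ring \<Rightarrow> (nat \<Rightarrow> 'a) \<Rightarrow> 'a dd_fm \<Rightarrow> bool" where
  "sat K v (Eq s t) \<longleftrightarrow> tm_val K v s = tm_val K v t"
| "sat K v (Neg \<phi>) \<longleftrightarrow> \<not> sat K v \<phi>"
| "sat K v (Conj \<phi> \<psi>) \<longleftrightarrow> sat K v \<phi> \<and> sat K v \<psi>"
| "sat K v (Ex i \<phi>) \<longleftrightarrow> (\<exists>x \<in> carrier K. sat K (v(i := x)) \<phi>)"

primrec tm_vars :: "'a dd_tm \<Rightarrow> nat set" where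
  "tm_vars (Var i) = {i}"
| "tm_vars (Const c) = {}"
| "tm_vars Zero = {}"
| "tm_vars One = {}"
| "tm_vars (Add s t) = tm_vars s \<union> tm_vars t"
| "tm_vars (Sub s t) = tm_vars s \<union> tm_vars t"
| "tm_vars (Mul s t) = tm_vars s \<union> tm_vars t"
| "tm_vars (Sig t) = tm_vars t"
| "tm_vars (Der t) = tm_vars t"

primrec free_vars :: "'a dd_fm \<Rightarrow> nat set" where
  "free_vars (Eq s t) = tm_vars s \<union> tm_vars t"
| "free_vars (Neg \<phi>) = free_vars \<phi>"
| "free_vars (Conj \<phi> \<psi>) = free_vars \<phi> \<union> free_vars \<psi>"
| "free_vars (Ex i \<phi>) = free_vars \<phi> - {i}"

primrec qfree :: "'a dd_fm \<Rightarrow> bool" where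
  "qfree (Eq s t) \<longleftrightarrow> True"
| "qfree (Neg \<phi>) \<longleftrightarrow> qfree \<phi>"
| "qfree (Conj \<phi> \<psi>) \<longleftrightarrow> qfree \<phi> \<and> qfree \<psi>"
| "qfree (Ex i \<phi>) \<longleftrightarrow> False"

section \<open>Saturated models of DCFA\<close>

text \<open>
  Extensions of \<open>U\<close> are given by embeddings into structures over the same type \<open>'a\<close>.
  This is no restriction: a solution of a formula in some extension already lies in an
  extension generated over \<open>U\<close> by finitely many elements, and such an extension has the
  cardinality of the infinite set \<open>carrier U\<close>, hence an isomorphic copy with the same
  carrier. Homomorphisms of fields are injective.
\<close>

definition DCFA_model :: "'a dd_ring \<Rightarrow> bool" where
  "DCFA_model U \<longleftrightarrow> dd_field U \<and>
     (\<forall>(L :: 'a dd_ring) f \<phi>. dd_field L \<longrightarrow> f \<in> dd_hom U L \<longrightarrow>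
        qfree \<phi> \<longrightarrow> fm_consts \<phi> \<subseteq> carrier U \<longrightarrow>
        (\<exists>w. range w \<subseteq> carrier L \<and> sat L w (map_dd_fm f \<phi>)) \<longrightarrow>
        (\<exists>v. range v \<subseteq> carrier U \<and> sat U v \<phi>))"

text \<open>Every finitely satisfiable set of formulas in the single variable \<open>0\<close>, with
  parameters in a set of cardinality less than that of \<open>U\<close>, is realised in \<open>U\<close>.\<close>

definition saturated :: "'a dd_ring \<Rightarrow> bool" where
  "saturated U \<longleftrightarrow> (\<forall>A \<Phi>. A \<subseteq> carrier U \<longrightarrow> A \<prec> carrier U \<longrightarrow>
     (\<forall>\<phi> \<in> \<Phi>. free_vars \<phi> \<subseteq> {0} \<and> fm_consts \<phi> \<subseteq> A) \<longrightarrow>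
     (\<forall>\<Phi>\<^sub>0 \<subseteq> \<Phi>. finite \<Phi>\<^sub>0 \<longrightarrow> (\<exists>x \<in> carrier U. \<forall>\<phi> \<in> \<Phi>\<^sub>0. sat U (\<lambda>_. x) \<phi>)) \<longrightarrow>
     (\<exists>x \<in> carrier U. \<forall>\<phi> \<in> \<Phi>. sat U (\<lambda>_. x) \<phi>))"

text \<open>An \<open>n\<close>-tuple is an extensional function on \<open>{..<n}\<close>.\<close>

definition definable :: "'a dd_ring \<Rightarrow> 'a set \<Rightarrow> nat \<Rightarrow> (nat \<Rightarrow> 'a) set \<Rightarrow> bool" where
  "definable U A n S \<longleftrightarrow> (\<exists>\<phi>. fm_consts \<phi> \<subseteq> A \<and> free_vars \<phi> \<subseteq> {..<n} \<and>
     S = {x \<in> {..<n} \<rightarrow>\<^sub>E carrier U. sat U x \<phi>})"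

abbreviation Ga_pow :: "'a dd_ring \<Rightarrow> nat \<Rightarrow> (nat \<Rightarrow> 'a) monoid" where
  "Ga_pow U n \<equiv> product_group {..<n} (\<lambda>_. add_monoid U)"

section \<open>Independence and 1-based sets\<close>

text \<open>The condition \<open>sig U ` K = K\<close> (rather than an inclusion) makes \<open>sig U\<close>
  an automorphism of \<open>K\<close>.\<close>

definition dd_subfield :: "'a set \<Rightarrow> 'a dd_ring \<Rightarrow> bool" where
  "dd_subfield K U \<longleftrightarrow> subfield K U \<and> sig U ` K = K \<and> der U ` K \<subseteq> K"

definition dd_generated :: "'a dd_ring \<Rightarrow> 'a set \<Rightarrow> 'a set" where
  "dd_generated U A = \<Inter>{K. dd_subfield K U \<and> A \<subseteq> K}"

definition acl :: "'a dd_ring \<Rightarrow> 'a set \<Rightarrow> 'a set" where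
  "acl U A = {x \<in> carrier U. ring.algebraic U (dd_generated U A) x}"

definition linearly_disjoint :: "'a dd_ring \<Rightarrow> 'a set \<Rightarrow> 'a set \<Rightarrow> 'a set \<Rightarrow> bool" where
  "linearly_disjoint U C E F \<longleftrightarrow>
     (\<forall>us. set us \<subseteq> E \<longrightarrow> ring.independent U C us \<longrightarrow> ring.independent U F us)"

definition indep_over :: "'a dd_ring \<Rightarrow> 'a set \<Rightarrow> 'a set \<Rightarrow> 'a set \<Rightarrow> bool" where
  "indep_over U C A B \<longleftrightarrow> linearly_disjoint U (acl U C) (acl U (A \<union> C)) (acl U (B \<union> C))"

definition coords :: "nat \<Rightarrow> nat \<Rightarrow> (nat \<Rightarrow> nat \<Rightarrow> 'a) \<Rightarrow> 'a set" where
  "coords n m a = {a i j | i j. i < m \<and> j < n}"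

definition one_based :: "'a dd_ring \<Rightarrow> 'a set \<Rightarrow> nat \<Rightarrow> (nat \<Rightarrow> 'a) set \<Rightarrow> bool" where
  "one_based U A n S \<longleftrightarrow>
     (\<forall>m k. \<forall>a \<in> {..<m} \<rightarrow>\<^sub>E S. \<forall>b \<in> {..<k} \<rightarrow>\<^sub>E S.
        indep_over U (acl U (A \<union> coords n m a) \<inter> acl U (A \<union> coords n k b))
          (coords n m a) (coords n k b))"

end

theory Submission
  imports Defs
begin

text \<open>
  Fix \<open>h \<noteq> 0\<close> in \<open>H\<close>. Integer multiples of elements of \<open>H\<close> lie in \<open>H\<close>, so saturation yields
  generic \<open>m, c, x\<close> in the field \<open>F\<close> of constants fixed by \<open>\<sigma>\<close> with \<open>m h, c h, x h, x (m h) \<in> H\<close>;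
  then \<open>y h \<in> H\<close> for \<open>y = m x + c\<close>. The line \<open>a = (h, m h, c h)\<close> and the point
  \<open>b = (h, x h, y h)\<close> contradict 1-basedness: \<open>1, m, c\<close> are linearly dependent over \<open>acl(b)\<close>,
  hence, by linear disjointness, over \<open>acl(Aa) \<inter> acl(Ab)\<close>, which would give \<open>m \<in> acl(Ab)\<close> or
  \<open>x \<in> acl(Aa)\<close>. Both are excluded by genericity and the exchange property of
  \<open>acl\<close> on \<open>F\<close>.
\<close>

section \<open>Roots of lists of coefficients\<close>

text \<open>\<open>acl\<close> as a whole has no exchange property: \<open>acl\<close> of z contains
  D z, while z need not be algebraic over the field generated by D z. This is why the multipliers
  are taken in F. Adjoining an element of F to a ring closed under \<sigma> and D yields just the
  polynomials in it, without new transforms or derivatives, so exchange becomes the classical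
  statement about polynomial equations in two unknowns. A second obstacle is that terms cannot
  express the inverse of \<sigma>, although generated fields are closed under it. An element fixed
  by \<sigma> avoids this: a power of \<sigma> applied to its equation moves the coefficients within
  reach of terms and leaves the root alone. Transcendence then becomes a set of inequations between
  terms, as saturation demands. Since H is only a group, it need not be stable under multiplication
  by F; the multipliers that send chosen vectors into H are generic points of a set which contains
  the integers. The configuration is that of a point on a line in the plane, where the slope cannot
  be read off from the point.\<close>

definition (in ring) alg_over :: "'a set \<Rightarrow> 'a \<Rightarrow> bool" where
  "alg_over S z \<longleftrightarrow> (\<exists>p. set p \<subseteq> S \<and> \<not> set p \<subseteq> {\<zero>} \<and> eval p z = \<zero>)"

lemma (in ring) normalize_eq_Nil_iff: "normalize p = [] \<longleftrightarrow> set p \<subseteq> {\<zero>}"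
  by (induction p) auto

text \<open>Normalising strips the leading zeros. \<open>alg_over\<close> admits them, so that
  coefficient lists can be mapped, scaled or assembled from sums without keeping track of the
  degree.\<close>

lemma (in ring) alg_over_imp_algebraic:
  assumes "S \<subseteq> carrier R" "z \<in> carrier R" "alg_over S z"
  shows "algebraic S z"
proof -
  obtain p where p: "set p \<subseteq> S" "\<not> set p \<subseteq> {\<zero>}" "eval p z = \<zero>"
    using assms(3) unfolding alg_over_def by blast
  have "normalize p \<in> carrier (S[X])" "normalize p \<noteq> []"
    using normalize_gives_polynomial[OF p(1)] p(2) normalize_eq_Nil_iff
    by (auto simp: univ_poly_def)
  moreover have "eval (normalize p) z = \<zero>"
    using eval_normalize[of p z] p assms by auto
  ultimately show ?thesis
    using algebraicI[of "normalize p" S z] unfolding over_def by blast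
qed

lemma (in domain) algebraic_imp_alg_over:
  assumes "subring S R" "z \<in> carrier R" "algebraic S z"
  shows "alg_over S z"
proof -
  obtain p where p: "p \<in> carrier (S[X])" "p \<noteq> []" "eval p z = \<zero>"
    using algebraicE[OF assms(1,2)] assms(3) unfolding over_def by blast
  then have "set p \<subseteq> S" "lead_coeff p \<noteq> \<zero>"
    by (auto simp: univ_poly_def polynomial_def)
  moreover have "lead_coeff p \<in> set p"
    using p(2) by simp
  ultimately show ?thesis
    using p(3) unfolding alg_over_def by blast
qed

lemma (in domain) finite_roots_list:
  assumes "set p \<subseteq> carrier R" "\<not> set p \<subseteq> {\<zero>}"
  shows "finite {x \<in> carrier R. eval p x = \<zero>}"
proof -
  have "normalize p \<in> carrier (poly_ring R)" "normalize p \<noteq> []"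
    using normalize_gives_polynomial[OF assms(1)] assms(2) normalize_eq_Nil_iff
    by (auto simp: univ_poly_def)
  then have "finite {x. is_root (normalize p) x}"
    by (rule_tac finite_number_of_roots)
  moreover have "{x \<in> carrier R. eval p x = \<zero>} \<subseteq> {x. is_root (normalize p) x}"
    using \<open>normalize p \<noteq> []\<close> eval_normalize[OF assms(1)] unfolding is_root_def by auto
  ultimately show ?thesis
    using finite_subset by blast
qed

text \<open>The bound N may exceed the length because \<open>coeff\<close> is zero there; this gives
  several polynomials one common range of summation.\<close>

lemma (in ring) eval_as_finsum:
  assumes "set p \<subseteq> carrier R" "z \<in> carrier R" "length p \<le> N"
  shows "eval p z = (\<Oplus>i\<in>{..<N}. coeff p i \<otimes> z [^] i)"
proof -
  have 1: "eval p z = (\<Oplus>i\<in>{..<length p}. coeff p i \<otimes> z [^] i)"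
    using assms(1)
  proof (induction p)
    case Nil
    then show ?case by simp
  next
    case (Cons a p)
    have "(\<Oplus>i\<in>{..<length p}. coeff (a # p) i \<otimes> z [^] i) = (\<Oplus>i\<in>{..<length p}. coeff p i \<otimes> z [^] i)"
      using Cons assms(2) by (intro finsum_cong') auto
    then show ?case
      using Cons assms(2) by (simp add: lessThan_Suc)
  qed
  have "(\<Oplus>i\<in>{..<length p + k}. coeff p i \<otimes> z [^] i) = eval p z" for k
    using assms(1,2) 1 eval_in_carrier[OF assms(1,2)]
    by (induction k) (auto simp: lessThan_Suc coeff_length)
  from this[of "N - length p"] show ?thesis
    using assms(3) by simp
qed

lemma (in ring) finsum_imp_alg_over:
  assumes "\<And>j. j < N \<Longrightarrow> f j \<in> S" "S \<subseteq> carrier R" "z \<in> carrier R"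
    and "(\<Oplus>j\<in>{..<N}. f j \<otimes> z [^] j) = \<zero>" "i < (N::nat)" "f i \<noteq> \<zero>"
  shows "alg_over S z"
proof -
  \<comment> \<open>\<open>eval\<close> takes the highest coefficient first, hence the reversed list
    of indices.\<close>
  have "eval (map f (rev [0..<k])) z = (\<Oplus>j\<in>{..<k}. f j \<otimes> z [^] j)" if "k \<le> N" for k
    using that
  proof (induction k)
    case (Suc k)
    have "(\<lambda>j. f j \<otimes> z [^] j) \<in> {..<k} \<rightarrow> carrier R" "f k \<in> carrier R"
      using Suc assms(2,3) assms(1)[THEN subsetD[OF assms(2)]] by auto
    then show ?case using Suc assms(3) by (simp add: lessThan_Suc)
  qed simp
  then have "eval (map f (rev [0..<N])) z = \<zero>"
    using assms(4) by simp
  moreover have "set (map f (rev [0..<N])) \<subseteq> S" "\<not> set (map f (rev [0..<N])) \<subseteq> {\<zero>}"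
    using assms(1,5,6) by (auto simp: image_subset_iff)
  ultimately show ?thesis
    unfolding alg_over_def by blast
qed

lemma (in abelian_monoid) finsum_lessThan_swap:
  fixes N M :: nat
  assumes "\<And>i j. i < N \<Longrightarrow> j < M \<Longrightarrow> g i j \<in> carrier G"
  shows "(\<Oplus>i\<in>{..<N}. \<Oplus>j\<in>{..<M}. g i j) = (\<Oplus>j\<in>{..<M}. \<Oplus>i\<in>{..<N}. g i j)"
  using assms
proof (induction N)
  case 0
  then show ?case by simp
next
  case (Suc N)
  have "(\<Oplus>j\<in>{..<M}. \<Oplus>i\<in>{..<Suc N}. g i j) = (\<Oplus>j\<in>{..<M}. g N j \<oplus> (\<Oplus>i\<in>{..<N}. g i j))"
    using Suc.prems by (intro finsum_cong') (auto simp: lessThan_Suc Pi_def intro!: finsum_closed)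
  also have "\<dots> = (\<Oplus>j\<in>{..<M}. g N j) \<oplus> (\<Oplus>j\<in>{..<M}. \<Oplus>i\<in>{..<N}. g i j)"
    using Suc.prems by (intro finsum_addf) (auto intro!: finsum_closed)
  finally show ?case
    using Suc by (simp add: lessThan_Suc Pi_def)
qed

text \<open>A bivariate polynomial vanishing at \<open>(y, z)\<close>, regarded as a polynomial in \<open>z\<close> over
  \<open>S[y]\<close>, is read as a polynomial in \<open>y\<close> over \<open>S[z]\<close>.\<close>

lemma (in domain) alg_over_exchange:
  assumes "subring S R" "subring T R" "S \<subseteq> T" "y \<in> carrier R" "z \<in> T"
    and "alg_over (simple_extension S y) z" "\<not> alg_over S z"
  shows "alg_over T y"
proof -
  have SR: "S \<subseteq> carrier R" and TR: "T \<subseteq> carrier R"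
    using assms(1,2) subringE(1) by blast+
  have z: "z \<in> carrier R"
    using assms(5) TR by blast
  let ?E = "simple_extension S y"
  have ER: "?E \<subseteq> carrier R"
    using simple_extension_in_carrier[OF SR assms(4)] .
  obtain P where P: "set P \<subseteq> ?E" "\<not> set P \<subseteq> {\<zero>}" "eval P z = \<zero>"
    using assms(6) unfolding alg_over_def by blast
  have "\<exists>q. set q \<subseteq> S \<and> eval q y = c" if "c \<in> ?E" for c
    using that unfolding simple_extension_as_eval_img[OF SR assms(4)]
    by (auto simp: univ_poly_def polynomial_def image_iff) 
       (metis empty_set empty_subsetI eval.simps(1))
  then obtain q where q: "\<And>c. c \<in> ?E \<Longrightarrow> set (q c) \<subseteq> S \<and> eval (q c) y = c"
    by metis
  define N where "N = length P"
  \<comment> \<open>\<open>\<zero>\<close> is inserted because \<open>coeff P i\<close> is zero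
    beyond the length of P, and the list chosen for it must be bounded by M as well.\<close>
  define M where "M = Max (length ` q ` (insert \<zero> (set P)))"
  define a where "a i j = coeff (q (coeff P i)) j" for i j
  have coeffP: "coeff P i \<in> insert \<zero> (set P)" for i
    using coeff_length[of P i] coeff_img_restrict[of P] by (cases "i < length P") auto
  have coeffE: "coeff P i \<in> ?E" for i
    using coeffP[of i] P(1) by auto
  have aS: "a i j \<in> S" for i j
    using q[OF coeffE, of i] coeff_length[of "q (coeff P i)" j] coeff_img_restrict[of "q (coeff P i)"]
      subringE(2)[OF assms(1)]
    unfolding a_def by (cases "j < length (q (coeff P i))") auto
  then have aR: "a i j \<in> carrier R" for i j
    using SR by blast
  have row: "coeff P i = (\<Oplus>j\<in>{..<M}. a i j \<otimes> y [^] j)" for i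
  proof -
    have "length (q (coeff P i)) \<le> M"
      unfolding M_def using coeffP[of i] by (intro Max_ge) auto
    then show ?thesis
      using eval_as_finsum[of "q (coeff P i)" y M] q[OF coeffE, of i] SR assms(4)
      unfolding a_def by auto
  qed
  \<comment> \<open>The rows of the matrix \<open>a\<close> are the coefficients of P as polynomials
    in y; summing column j against the powers of z gives the coefficient of the j-th power of
    y.\<close>
  define b where "b j = (\<Oplus>i\<in>{..<N}. a i j \<otimes> z [^] i)" for j
  have pow_T: "z [^] (i::nat) \<in> T" for i
    by (induction i) (use assms(2,5) subringE(3,6) in \<open>auto\<close>)
  have bT: "b j \<in> T" for j
  proof -
    have "(\<Oplus>i\<in>{..<k}. a i j \<otimes> z [^] i) \<in> T" for k :: nat
    proof (induction k)
      case 0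
      then show ?case using subringE(2)[OF assms(2)] by simp
    next
      case (Suc k)
      have "a k j \<otimes> z [^] k \<in> T"
        using subringE(6)[OF assms(2)] aS assms(3) pow_T by blast
      then show ?case
        using Suc subringE(7)[OF assms(2)] aR z by (simp add: lessThan_Suc Pi_def)
    qed
    then show ?thesis
      unfolding b_def .
  qed
  have "\<zero> = (\<Oplus>i\<in>{..<N}. coeff P i \<otimes> z [^] i)"
    using eval_as_finsum[of P z N] P ER z unfolding N_def by auto
  also have "\<dots> = (\<Oplus>i\<in>{..<N}. \<Oplus>j\<in>{..<M}. (a i j \<otimes> z [^] i) \<otimes> y [^] j)"
  proof (intro finsum_cong')
    fix i assume "i \<in> {..<N}"
    have "coeff P i \<otimes> z [^] i = (\<Oplus>j\<in>{..<M}. (a i j \<otimes> y [^] j) \<otimes> z [^] i)"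
      unfolding row[of i] using aR z assms(4) by (intro finsum_ldistr) auto
    also have "\<dots> = (\<Oplus>j\<in>{..<M}. (a i j \<otimes> z [^] i) \<otimes> y [^] j)"
      using aR z assms(4) by (intro finsum_cong') (auto simp: m_ac)
    finally show "coeff P i \<otimes> z [^] i = (\<Oplus>j\<in>{..<M}. (a i j \<otimes> z [^] i) \<otimes> y [^] j)" .
  qed (use aR z assms(4) in \<open>auto intro!: finsum_closed\<close>)
  also have "\<dots> = (\<Oplus>j\<in>{..<M}. \<Oplus>i\<in>{..<N}. (a i j \<otimes> z [^] i) \<otimes> y [^] j)"
    using aR z assms(4) by (intro finsum_lessThan_swap) auto
  also have "\<dots> = (\<Oplus>j\<in>{..<M}. b j \<otimes> y [^] j)"
  proof (intro finsum_cong')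
    fix j assume "j \<in> {..<M}"
    show "(\<Oplus>i\<in>{..<N}. (a i j \<otimes> z [^] i) \<otimes> y [^] j) = b j \<otimes> y [^] j"
      unfolding b_def using aR z assms(4) by (intro finsum_ldistr[symmetric]) auto
  qed (use bT TR assms(4) in auto)
  finally have sum0: "(\<Oplus>j\<in>{..<M}. b j \<otimes> y [^] j) = \<zero>" by simp
  obtain i where i: "i < N" "coeff P i \<noteq> \<zero>"
    using P(2) unfolding coeff_img_restrict[of P, symmetric] N_def by auto
  have "\<exists>j<M. a i j \<noteq> \<zero>"
  proof (rule ccontr)
    assume "\<not> (\<exists>j<M. a i j \<noteq> \<zero>)"
    then have "(\<Oplus>j\<in>{..<M}. a i j \<otimes> y [^] j) = (\<Oplus>j\<in>{..<M}. \<zero>)"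
      using assms(4) by (intro finsum_cong') auto
    then show False
      using row[of i] i(2) by simp
  qed
  then obtain j where j: "j < M" "a i j \<noteq> \<zero>" by blast
  \<comment> \<open>If \<open>b j\<close> were zero, column j would be an equation for z over S with
    the nonzero entry \<open>a i j\<close>.\<close>
  have "b j \<noteq> \<zero>"
    using finsum_imp_alg_over[of N "\<lambda>i. a i j" S z i] assms(7) aS SR z i(1) j(2)
    unfolding b_def by blast
  then show ?thesis
    using finsum_imp_alg_over[of M b T y j] bT TR assms(4) sum0 j(1) by blast
qed

lemma (in ring) eval_in_subring:
  assumes "subring S R" "set p \<subseteq> S" "z \<in> S"
  shows "eval p z \<in> S"
proof -
  have "z [^] (n::nat) \<in> S" for n
    using subringE(3,6)[OF assms(1)] assms(3) by (induction n) auto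
  with assms(2) show ?thesis
    using subringE(2,6,7)[OF assms(1)] by (induction p) auto
qed

text \<open>Degrees multiply in towers: the coefficients generate a finite extension of L, over
  which z has finite degree, so z lies in a finite extension of L.\<close>

lemma (in domain) algebraic_trans:
  assumes "subfield L R" "set p \<subseteq> carrier R" "\<And>c. c \<in> set p \<Longrightarrow> algebraic L c"
    and "\<not> set p \<subseteq> {\<zero>}" "z \<in> carrier R" "eval p z = \<zero>"
  shows "algebraic L z"
proof -
  define E where "E = finite_extension L p"
  have E: "subfield E R" "finite_dimension L E" "set p \<subseteq> E"
    unfolding E_def
    using finite_extension_is_subfield[OF assms(1,2)] finite_extension_finite_dimension(1)[OF assms(1,2)]
      finite_extension_mem[OF subfieldE(1)[OF assms(1)] assms(2)] assms(3)
    by (auto simp: over_def)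
  have "alg_over E z"
    unfolding alg_over_def using E(3) assms(4,6) by blast
  then have "algebraic E z"
    using alg_over_imp_algebraic subfieldE(3)[OF E(1)] assms(5) by blast
  then have "finite_dimension E (simple_extension E z)"
    using finite_dimension_simple_extension[OF E(1) assms(5)] by (simp add: over_def)
  then have "finite_dimension L (simple_extension E z)"
    using telescopic_base_dim(1)[OF assms(1) E(1,2)] by blast
  then have "finite_dimension L (finite_extension L (z # p))"
    unfolding E_def by simp
  then show ?thesis
    using finite_extension_finite_dimension(2)[of L "z # p" z] assms(1,2,5) by (auto simp: over_def)
qed

section \<open>Arithmetic of difference-differential fields\<close>

primrec (in ring) formal_deriv :: "'a list \<Rightarrow> 'a list" where
  "formal_deriv [] = []"
| "formal_deriv (c # p) = (if p = [] then [] else ([length p] \<cdot> c) # formal_deriv p)"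

lemma (in ring) length_formal_deriv: "length (formal_deriv p) = length p - 1"
  by (induction p) (auto simp: Suc_diff_1)

lemma (in ring) set_formal_deriv:
  assumes "subring S R" "set p \<subseteq> S"
  shows "set (formal_deriv p) \<subseteq> S"
proof -
  have "[n] \<cdot> c \<in> S" if "c \<in> S" for c and n :: nat
    using subringE(2,7)[OF assms(1)] that by (induction n) auto
  with assms(2) show ?thesis
    by (induction p) auto
qed

context dd_field
begin

sublocale sg: ring_hom_ring K K "sig K"
  using sig_aut ring_axioms by (auto intro!: ring_hom_ringI2 simp: ring_iso_def)

lemma sig_closed: "x \<in> carrier K \<Longrightarrow> sig K x \<in> carrier K"
  by simp

lemma sig_inj: "x \<in> carrier K \<Longrightarrow> y \<in> carrier K \<Longrightarrow> sig K x = sig K y \<longleftrightarrow> x = y"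
  using sig_aut inj_on_eq_iff[of "sig K" "carrier K"] unfolding ring_iso_def bij_betw_def by blast

lemma sig_surj: "sig K ` carrier K = carrier K"
  using sig_aut unfolding ring_iso_def bij_betw_def by blast

lemma sig_eq_zero_iff: "x \<in> carrier K \<Longrightarrow> sig K x = \<zero> \<longleftrightarrow> x = \<zero>"
  using sig_inj[of x \<zero>] by simp

lemma der_zero: "der K \<zero> = \<zero>"
  using der_add[of \<zero> \<zero>] der_closed[of \<zero>] by simp

lemma der_one: "der K \<one> = \<zero>"
  using der_mult[of \<one> \<one>] der_closed[of \<one>] by simp

lemma der_nat_mult: "x \<in> carrier K \<Longrightarrow> der K ([n] \<cdot> x) = [(n::nat)] \<cdot> der K x"
  by (induction n) (auto simp: der_zero der_add der_closed)

lemma der_pow: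
  assumes "z \<in> carrier K"
  shows "der K (z [^] Suc n) = [Suc n] \<cdot> (z [^] n) \<otimes> der K z"
proof (induction n)
  case 0
  then show ?case using assms by (simp add: der_closed)
next
  case (Suc n)
  have "der K (z [^] Suc (Suc n)) = der K (z [^] Suc n) \<otimes> z \<oplus> z [^] Suc n \<otimes> der K z"
    using der_mult[of "z [^] Suc n" z] assms by simp
  also have "\<dots> = [Suc n] \<cdot> (z [^] n) \<otimes> der K z \<otimes> z \<oplus> z [^] Suc n \<otimes> der K z"
    using Suc by simp
  also have "\<dots> = ([Suc n] \<cdot> (z [^] n) \<otimes> z \<oplus> z [^] Suc n) \<otimes> der K z"
    using assms der_closed[OF assms] by (simp add: l_distr r_distr m_ac del: add.nat_pow_Suc nat_pow_Suc)
  also have "[Suc n] \<cdot> (z [^] n) \<otimes> z = [Suc n] \<cdot> (z [^] Suc n)"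
    using assms by (simp add: add_pow_ldistr del: add.nat_pow_Suc)
  also have "[Suc n] \<cdot> (z [^] Suc n) \<oplus> z [^] Suc n = [Suc (Suc n)] \<cdot> (z [^] Suc n)"
    by simp
  finally show ?case .
qed

lemma der_eval:
  assumes "set p \<subseteq> carrier K" "z \<in> carrier K"
  shows "der K (eval p z) = eval (map (der K) p) z \<oplus> eval (formal_deriv p) z \<otimes> der K z"
  using assms(1)
proof (induction p)
  case Nil
  then show ?case using assms by (simp add: der_zero der_closed)
next
  case (Cons c p)
  have c: "c \<in> carrier K" "der K c \<in> carrier K" "der K z \<in> carrier K"
    using Cons assms der_closed by auto
  have "set (map (der K) p) \<subseteq> carrier K"
    using Cons.prems der_closed by auto
  then have ev: "eval p z \<in> carrier K" "eval (map (der K) p) z \<in> carrier K" "eval (formal_deriv p) z \<in> carrier K"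
    using Cons.prems assms(2) set_formal_deriv[OF carrier_is_subring, of p]
    by (auto intro!: eval_in_carrier simp del: set_map)
  show ?case
  proof (cases p)
    case Nil
    then show ?thesis using c by simp
  next
    case (Cons b q)
    then obtain n where n: "length p = Suc n" by simp
    have pn: "p \<noteq> []" using Cons by simp
    have zn: "z [^] n \<in> carrier K" "z [^] Suc n \<in> carrier K" "[Suc n] \<cdot> c \<in> carrier K"
      using assms c by auto
    have *: "c \<otimes> ([Suc n] \<cdot> (z [^] n) \<otimes> der K z) = [Suc n] \<cdot> c \<otimes> z [^] n \<otimes> der K z"
      using c assms zn(1) by (simp add: m_assoc[symmetric] add_pow_rdistr add_pow_ldistr del: add.nat_pow_Suc)
    have "der K (eval (c # p) z) = der K (c \<otimes> z [^] Suc n) \<oplus> der K (eval p z)"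
      using der_add c ev zn n by simp
    also have "der K (c \<otimes> z [^] Suc n) = der K c \<otimes> z [^] Suc n \<oplus> c \<otimes> der K (z [^] Suc n)"
      using der_mult c zn by blast
    also have "c \<otimes> der K (z [^] Suc n) = [Suc n] \<cdot> c \<otimes> z [^] n \<otimes> der K z"
      using der_pow[OF assms(2)] * by simp
    also have "der K (eval p z) = eval (map (der K) p) z \<oplus> eval (formal_deriv p) z \<otimes> der K z"
      using Cons.IH Cons.prems by simp
    also have "der K c \<otimes> z [^] Suc n \<oplus> [Suc n] \<cdot> c \<otimes> z [^] n \<otimes> der K z \<oplus>
        (eval (map (der K) p) z \<oplus> eval (formal_deriv p) z \<otimes> der K z) =
        (der K c \<otimes> z [^] Suc n \<oplus> eval (map (der K) p) z) \<oplus>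
        ([Suc n] \<cdot> c \<otimes> z [^] n \<oplus> eval (formal_deriv p) z) \<otimes> der K z"
      using c ev zn by (simp add: l_distr a_ac del: nat_pow_Suc add.nat_pow_Suc)
    also have "\<dots> = eval (map (der K) (c # p)) z \<oplus> eval (formal_deriv (c # p)) z \<otimes> der K z"
      using pn n length_formal_deriv[of p] by (simp del: nat_pow_Suc add.nat_pow_Suc)
    finally show ?thesis .
  qed
qed

section \<open>Algebraic closure\<close>

lemma dd_subfieldD:
  assumes "dd_subfield L K"
  shows "subfield L K" "subring L K" "L \<subseteq> carrier K" "\<And>x. x \<in> L \<Longrightarrow> sig K x \<in> L"
    "\<And>x. x \<in> L \<Longrightarrow> der K x \<in> L" "\<And>x. x \<in> carrier K \<Longrightarrow> sig K x \<in> L \<Longrightarrow> x \<in> L"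
proof -
  show *: "subfield L K" "subring L K" "L \<subseteq> carrier K" "\<And>x. x \<in> L \<Longrightarrow> sig K x \<in> L"
    "\<And>x. x \<in> L \<Longrightarrow> der K x \<in> L"
    using assms subfieldE(1,3) unfolding dd_subfield_def by auto
  fix x assume "x \<in> carrier K" "sig K x \<in> L"
  then obtain y where "y \<in> L" "sig K x = sig K y"
    using assms unfolding dd_subfield_def by (metis imageE)
  then show "x \<in> L"
    using sig_inj \<open>x \<in> carrier K\<close> *(3) by auto
qed

lemma dd_subfieldI:
  assumes "subfield L K" "\<And>x. x \<in> L \<Longrightarrow> sig K x \<in> L" "\<And>x. x \<in> L \<Longrightarrow> der K x \<in> L"
    and "\<And>x. x \<in> carrier K \<Longrightarrow> sig K x \<in> L \<Longrightarrow> x \<in> L"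
  shows "dd_subfield L K"
proof -
  have "L \<subseteq> sig K ` L"
  proof
    fix y assume "y \<in> L"
    then obtain x where "x \<in> carrier K" "y = sig K x"
      using sig_surj subfieldE(3)[OF assms(1)] by blast
    then show "y \<in> sig K ` L"
      using assms(4) \<open>y \<in> L\<close> by blast
  qed
  then show ?thesis
    unfolding dd_subfield_def using assms by blast
qed

lemma dd_subfield_carrier: "dd_subfield (carrier K) K"
  by (intro dd_subfieldI carrier_is_subfield) (auto simp: der_closed)

lemma dd_generated_incl: "B \<subseteq> dd_generated K B"
  unfolding dd_generated_def by blast

lemma dd_generated_minimal: "dd_subfield L K \<Longrightarrow> B \<subseteq> L \<Longrightarrow> dd_generated K B \<subseteq> L"
  unfolding dd_generated_def by blast

lemma dd_subfield_dd_generated: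
  assumes "B \<subseteq> carrier K"
  shows "dd_subfield (dd_generated K B) K"
proof -
  let ?S = "{L. dd_subfield L K \<and> B \<subseteq> L}"
  have ne: "?S \<noteq> {}"
    using dd_subfield_carrier assms by blast
  show ?thesis
    unfolding dd_generated_def
  proof (intro dd_subfieldI subfieldI')
    show "subring (\<Inter>?S) K"
      using ne dd_subfieldD(2) by (intro subring_Inter) auto
  next
    fix k assume "k \<in> \<Inter>?S - {\<zero>}"
    then show "inv k \<in> \<Inter>?S"
      using subfield_m_inv(1)[OF dd_subfieldD(1)] by fastforce
  qed (use dd_subfieldD in blast)+
qed

lemma acl_iff:
  assumes "B \<subseteq> carrier K"
  shows "z \<in> acl K B \<longleftrightarrow> z \<in> carrier K \<and> alg_over (dd_generated K B) z"
  using algebraic_imp_alg_over[OF dd_subfieldD(2)[OF dd_subfield_dd_generated[OF assms]]]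
    alg_over_imp_algebraic[OF dd_subfieldD(3)[OF dd_subfield_dd_generated[OF assms]]]
  unfolding acl_def by blast

lemma acl_carrier: "acl K B \<subseteq> carrier K"
  unfolding acl_def by blast

lemma dd_generated_subset_acl:
  assumes "B \<subseteq> carrier K"
  shows "dd_generated K B \<subseteq> acl K B"
  using algebraic_self[OF dd_subfieldD(2)[OF dd_subfield_dd_generated[OF assms]]]
    dd_subfieldD(3)[OF dd_subfield_dd_generated[OF assms]]
  unfolding acl_def over_def by blast

lemma subset_acl: "B \<subseteq> carrier K \<Longrightarrow> B \<subseteq> acl K B"
  using dd_generated_subset_acl dd_generated_incl by blast

lemma subfield_acl: "B \<subseteq> carrier K \<Longrightarrow> subfield (acl K B) K"
  using subfield_of_algebraics[OF dd_subfieldD(1)[OF dd_subfield_dd_generated]]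
  unfolding acl_def over_def by blast

text \<open>Differentiating an equation \<open>p z = 0\<close> of minimal degree expresses \<open>D z\<close> rationally in \<open>z\<close>:
  the coefficient \<open>p' z\<close> of \<open>D z\<close> is nonzero in characteristic \<open>0\<close>.\<close>

lemma der_acl:
  assumes B: "B \<subseteq> carrier K" and z: "z \<in> acl K B"
  shows "der K z \<in> acl K B"
proof -
  let ?L = "dd_generated K B"
  have L: "dd_subfield ?L K"
    using dd_subfield_dd_generated[OF B] .
  note LD = dd_subfieldD[OF L]
  let ?Q = "\<lambda>p. set p \<subseteq> ?L \<and> \<not> set p \<subseteq> {\<zero>} \<and> eval p z = \<zero>"
  have zK: "z \<in> carrier K" and "\<exists>p. ?Q p"
    using z acl_iff[OF B] unfolding alg_over_def by auto
  then obtain p where p: "?Q p" and min: "\<And>q. ?Q q \<Longrightarrow> length p \<le> length q"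
    using ex_has_least_nat[of ?Q _ length] by blast
  have pK: "set p \<subseteq> carrier K"
    using p LD(3) by blast
  obtain c q where pq: "p = c # q"
    using p by (cases p) auto
  have cK: "c \<in> carrier K" "c \<in> ?L"
    using pK p pq by auto
  \<comment> \<open>A zero head could be dropped, against the minimal length of p.\<close>
  have c: "c \<noteq> \<zero>"
  proof
    assume "c = \<zero>"
    then have "?Q q"
      using p pq zK eval_in_carrier[of q z] pK by auto
    then show False
      using min pq by fastforce
  qed
  have q: "q \<noteq> []"
    using p pq cK c by auto
  let ?d = "formal_deriv p"
  have "[length q] \<cdot> c = ([length q] \<cdot> \<one>) \<otimes> c"
    using cK by (simp add: add_pow_ldistr)
  then have "[length q] \<cdot> c \<noteq> \<zero>"
    using char_0[of "length q"] q c cK integral by auto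
  then have "\<not> set ?d \<subseteq> {\<zero>}"
    using pq q by simp
  moreover have d: "set ?d \<subseteq> ?L"
    using set_formal_deriv[OF LD(2)] p by blast
  moreover have "length ?d < length p"
    using pq by (simp add: length_formal_deriv)
  \<comment> \<open>The formal derivative is shorter than p and not identically zero, so by
    minimality it does not vanish at z.\<close>
  ultimately have d0: "eval ?d z \<noteq> \<zero>"
    using min[of ?d] by auto
  have A: "subring (acl K B) K"
    using subfieldE(1)[OF subfield_acl[OF B]] .
  have LA: "?L \<subseteq> acl K B"
    using dd_generated_subset_acl[OF B] .
  have "set (map (der K) p) \<subseteq> ?L"
    using p LD(5) by auto
  have dA: "eval ?d z \<in> acl K B" "eval (map (der K) p) z \<in> acl K B"
    using eval_in_subring[OF A _ z] d LA \<open>set (map (der K) p) \<subseteq> ?L\<close> by blast+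
  have dz: "der K z \<in> carrier K"
    using der_closed zK by blast
  have dK: "eval ?d z \<in> carrier K" "eval (map (der K) p) z \<in> carrier K"
    using dA acl_carrier by blast+
  have "eval ?d z \<otimes> der K z \<oplus> eval (map (der K) p) z = \<zero>"
    using der_eval[OF pK zK] p der_zero dK dz a_comm by simp
  then have "eval ?d z \<otimes> der K z = \<ominus> eval (map (der K) p) z"
    using minus_equality[of "eval ?d z \<otimes> der K z"] dK dz by simp
  then have "eval ?d z \<otimes> der K z \<in> acl K B"
    using subringE(5)[OF A dA(2)] by simp
  then show ?thesis
    using subfield_m_inv_simprule[OF subfield_acl[OF B]] dA d0 dz by blast
qed

text \<open>\<sigma> permutes the generated field, so it carries an equation for z over that field
  to one for \<open>sig K z\<close>; conversely each coefficient of an equation for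
  \<open>sig K z\<close> has a preimage in the field, and injectivity of \<sigma> returns an
  equation for z.\<close>

lemma dd_subfield_acl:
  assumes B: "B \<subseteq> carrier K"
  shows "dd_subfield (acl K B) K"
proof (intro dd_subfieldI subfield_acl[OF B] der_acl[OF B])
  let ?L = "dd_generated K B"
  note LD = dd_subfieldD[OF dd_subfield_dd_generated[OF B]]
  have img: "sig K ` ?L = ?L"
    using dd_subfield_dd_generated[OF B] unfolding dd_subfield_def by blast
  fix z
  {
    assume "z \<in> acl K B"
    then obtain p where z: "z \<in> carrier K" and p: "set p \<subseteq> ?L" "\<not> set p \<subseteq> {\<zero>}" "eval p z = \<zero>"
      unfolding acl_iff[OF B] alg_over_def by blast
    have "eval (map (sig K) p) (sig K z) = \<zero>"
      using sg.eval_hom'[OF z, of p] p LD(3) by auto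
    moreover have "set (map (sig K) p) \<subseteq> ?L" "\<not> set (map (sig K) p) \<subseteq> {\<zero>}"
      using p LD(3,4) sig_eq_zero_iff by (auto simp: subset_iff)
    ultimately show "sig K z \<in> acl K B"
      unfolding acl_iff[OF B] alg_over_def using sig_closed[OF z] by blast
  next
    assume z: "z \<in> carrier K" and "sig K z \<in> acl K B"
    then obtain q where q: "set q \<subseteq> ?L" "\<not> set q \<subseteq> {\<zero>}" "eval q (sig K z) = \<zero>"
      unfolding acl_iff[OF B] alg_over_def by blast
    have "q \<in> lists (sig K ` ?L)"
      using q(1) img by auto
    then obtain p where p: "set p \<subseteq> ?L" "q = map (sig K) p"
      unfolding lists_image by auto
    have "sig K (eval p z) = \<zero>"
      using sg.eval_hom'[OF z, of p] p q LD(3) by auto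
    then have "eval p z = \<zero>"
      using sig_eq_zero_iff eval_in_carrier[of p z] p LD(3) z by blast
    moreover have "\<not> set p \<subseteq> {\<zero>}"
      using q(2) p(2) by auto
    ultimately show "z \<in> acl K B"
      unfolding acl_iff[OF B] alg_over_def using z p by blast
  }
qed

text \<open>\<open>acl K C\<close> is itself a difference-differential subfield, so it contains the
  field generated by B; transitivity of algebraicity does the rest.\<close>

lemma acl_minimal:
  assumes C: "C \<subseteq> carrier K" and "B \<subseteq> acl K C"
  shows "acl K B \<subseteq> acl K C"
proof
  have B: "B \<subseteq> carrier K"
    using assms(2) acl_carrier by blast
  fix z assume "z \<in> acl K B"
  then obtain p where z: "z \<in> carrier K" and
    p: "set p \<subseteq> dd_generated K B" "\<not> set p \<subseteq> {\<zero>}" "eval p z = \<zero>"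
    unfolding acl_iff[OF B] alg_over_def by blast
  have "set p \<subseteq> acl K C"
    using p(1) dd_generated_minimal[OF dd_subfield_acl[OF C] assms(2)] by blast
  then have "algebraic (dd_generated K C) z"
    using p z by (intro algebraic_trans[of "dd_generated K C" p z]
      dd_subfieldD(1)[OF dd_subfield_dd_generated[OF C]]) (auto simp: acl_def)
  then show "z \<in> acl K C"
    unfolding acl_def using z by blast
qed

lemma acl_mono: "C \<subseteq> carrier K \<Longrightarrow> B \<subseteq> C \<Longrightarrow> acl K B \<subseteq> acl K C"
  using acl_minimal subset_acl by blast

end

section \<open>Closed terms\<close>

lemma tm_val_cong: "(\<And>i. i \<in> tm_vars t \<Longrightarrow> v i = w i) \<Longrightarrow> tm_val K v t = tm_val K w t"
  by (induction t) auto

lemma sat_cong: "(\<And>i. i \<in> free_vars \<phi> \<Longrightarrow> v i = w i) \<Longrightarrow> sat K v \<phi> \<longleftrightarrow> sat K w \<phi>"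
proof (induction \<phi> arbitrary: v w)
  case (Eq s t)
  then show ?case
    using tm_val_cong[of s v w K] tm_val_cong[of t v w K] by auto
next
  case (Neg \<phi>)
  then show ?case by (metis free_vars.simps(2) sat.simps(2))
next
  case (Conj \<phi> \<psi>)
  then show ?case by (metis UnCI free_vars.simps(3) sat.simps(3))
next
  case (Ex i \<phi>)
  have "sat K (v(i := x)) \<phi> \<longleftrightarrow> sat K (w(i := x)) \<phi>" for x
    using Ex.prems by (intro Ex.IH) auto
  then show ?case by simp
qed

section \<open>Quotient fields inside a field, and clearing of denominators\<close>

definition (in ring) fractions :: "'a set \<Rightarrow> 'a set" where
  "fractions S = {u \<in> carrier R. \<exists>t \<in> S. t \<noteq> \<zero> \<and> u \<otimes> t \<in> S}"

lemma (in ring) fractionsI: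
  "u \<in> carrier R \<Longrightarrow> t \<in> S \<Longrightarrow> t \<noteq> \<zero> \<Longrightarrow> u \<otimes> t \<in> S \<Longrightarrow> u \<in> fractions S"
  unfolding fractions_def by blast

lemma (in ring) subset_fractions: "subring S R \<Longrightarrow> \<one> \<noteq> \<zero> \<Longrightarrow> S \<subseteq> fractions S"
  using subringE(1,3)[of S R] unfolding fractions_def by fastforce

lemma (in field) subfield_fractions:
  assumes "subring S R"
  shows "subfield (fractions S) R"
proof -
  note S = subringE[OF assms]
  show ?thesis
  proof (intro subfieldI' subringI)
    show "fractions S \<subseteq> carrier R"
      unfolding fractions_def by blast
    show "\<one> \<in> fractions S"
      using subset_fractions[OF assms] S(3) by auto
  next
    fix u assume "u \<in> fractions S"
    then obtain t where u: "u \<in> carrier R" "t \<in> S" "t \<noteq> \<zero>" "u \<otimes> t \<in> S"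
      unfolding fractions_def by blast
    moreover have "\<ominus> u \<otimes> t = \<ominus> (u \<otimes> t)"
      using u S(1) l_minus by blast
    ultimately show "\<ominus> u \<in> fractions S"
      using S(5) unfolding fractions_def by auto
  next
    fix u v assume "u \<in> fractions S" "v \<in> fractions S"
    then obtain t r where u: "u \<in> carrier R" "t \<in> S" "t \<noteq> \<zero>" "u \<otimes> t \<in> S"
      and v: "v \<in> carrier R" "r \<in> S" "r \<noteq> \<zero>" "v \<otimes> r \<in> S"
      unfolding fractions_def by blast
    have c: "t \<in> carrier R" "r \<in> carrier R"
      using u v S(1) by auto
    have tr: "t \<otimes> r \<in> S" "t \<otimes> r \<noteq> \<zero>"
      using S(6) u v c integral by blast+
    have "(u \<otimes> v) \<otimes> (t \<otimes> r) = (u \<otimes> t) \<otimes> (v \<otimes> r)"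
      using u v c by (simp add: m_ac)
    then show "u \<otimes> v \<in> fractions S"
      using fractionsI[of "u \<otimes> v" "t \<otimes> r" S] tr u(1) v(1) S(6)[OF u(4) v(4)] by simp
    have "(u \<oplus> v) \<otimes> (t \<otimes> r) = (u \<otimes> t) \<otimes> r \<oplus> (v \<otimes> r) \<otimes> t"
      using u v c by (simp add: m_ac l_distr r_distr)
    then show "u \<oplus> v \<in> fractions S"
      using fractionsI[of "u \<oplus> v" "t \<otimes> r" S] tr u(1) v(1) S(7)[OF S(6)[OF u(4) v(2)] S(6)[OF v(4) u(2)]]
      by simp
  next
    fix u assume "u \<in> fractions S - {\<zero>}"
    then obtain t where u: "u \<in> carrier R" "u \<noteq> \<zero>" "t \<in> S" "t \<noteq> \<zero>" "u \<otimes> t \<in> S"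
      unfolding fractions_def by blast
    have t: "t \<in> carrier R"
      using u S(1) by blast
    have i: "inv u \<in> carrier R" "inv u \<otimes> u = \<one>"
      using u field_Units by auto
    have "inv u \<otimes> (u \<otimes> t) = t"
      using i t u by (simp add: m_assoc[symmetric])
    moreover have "u \<otimes> t \<noteq> \<zero>"
      using u t integral by blast
    ultimately show "inv u \<in> fractions S"
      unfolding fractions_def using u i by auto
  qed
qed

text \<open>An equation over the quotient field is multiplied by a common nonzero denominator of its
  coefficients.\<close>

lemma (in domain) alg_over_fractions:
  assumes "subring S R" "z \<in> carrier R" "alg_over (fractions S) z"
  shows "alg_over S z"
proof -
  note S = subringE[OF assms(1)]
  have common: "\<exists>t \<in> S. t \<noteq> \<zero> \<and> (\<forall>c \<in> set p. t \<otimes> c \<in> S)" if "set p \<subseteq> fractions S" for p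
    using that
  proof (induction p)
    case Nil
    then show ?case using S(3) one_not_zero by (auto intro!: bexI[of _ \<one>])
  next
    case (Cons a p)
    then obtain t where t: "t \<in> S" "t \<noteq> \<zero>" "\<And>c. c \<in> set p \<Longrightarrow> t \<otimes> c \<in> S" by auto
    obtain r where r: "a \<in> carrier R" "r \<in> S" "r \<noteq> \<zero>" "a \<otimes> r \<in> S"
      using Cons.prems unfolding fractions_def by auto
    have c: "t \<in> carrier R" "r \<in> carrier R"
      using t r S(1) by auto
    have "t \<otimes> r \<in> S" "t \<otimes> r \<noteq> \<zero>"
      using S(6) t r c integral by blast+
    moreover have "t \<otimes> r \<otimes> a = t \<otimes> (a \<otimes> r)"
      using c r by (simp add: m_ac)
    moreover have "t \<otimes> r \<otimes> d = r \<otimes> (t \<otimes> d)" if "d \<in> set p" for d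
      using c that Cons.prems unfolding fractions_def by (auto simp: m_ac)
    ultimately show ?case
      using t r S(6) by (intro bexI[of _ "t \<otimes> r"]) auto
  qed
  obtain p where p: "set p \<subseteq> fractions S" "\<not> set p \<subseteq> {\<zero>}" "eval p z = \<zero>"
    using assms(3) unfolding alg_over_def by blast
  have pR: "set p \<subseteq> carrier R"
    using p(1) unfolding fractions_def by blast
  obtain t where t: "t \<in> S" "t \<noteq> \<zero>" "\<And>c. c \<in> set p \<Longrightarrow> t \<otimes> c \<in> S"
    using common[OF p(1)] by blast
  have tR: "t \<in> carrier R"
    using t S(1) by blast
  have "eval (map ((\<otimes>) t) q) z = t \<otimes> eval q z" if "set q \<subseteq> carrier R" for q
    using that tR assms(2) by (induction q) (auto simp: r_distr m_assoc eval_in_carrier)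
  then have "eval (map ((\<otimes>) t) p) z = \<zero>"
    using p(3) pR tR by simp
  moreover have "set (map ((\<otimes>) t) p) \<subseteq> S"
    using t(3) by auto
  moreover have "\<not> set (map ((\<otimes>) t) p) \<subseteq> {\<zero>}"
    using p(2) t(2) tR pR integral by (auto simp: image_subset_iff subset_iff)
  ultimately show ?thesis
    unfolding alg_over_def by blast
qed

section \<open>Values of closed terms and the field they generate\<close>

context dd_field
begin

text \<open>This is the smallest ring containing B and closed under \<sigma> and D. Describing it by
  terms makes every element nameable in a formula with parameters in B. The assignment is
  immaterial, as the terms have no variables.\<close>

definition term_ring :: "'a set \<Rightarrow> 'a set" where
  "term_ring B = tm_val K (\<lambda>_. \<zero>) ` {t. tm_vars t = {} \<and> tm_consts t \<subseteq> B}"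

lemma
  shows term_ring_const: "c \<in> B \<Longrightarrow> c \<in> term_ring B"
    and term_ring_zero: "\<zero> \<in> term_ring B"
    and term_ring_one: "\<one> \<in> term_ring B"
    and term_ring_add: "x \<in> term_ring B \<Longrightarrow> y \<in> term_ring B \<Longrightarrow> x \<oplus> y \<in> term_ring B"
    and term_ring_sub: "x \<in> term_ring B \<Longrightarrow> y \<in> term_ring B \<Longrightarrow> x \<ominus> y \<in> term_ring B"
    and term_ring_mult: "x \<in> term_ring B \<Longrightarrow> y \<in> term_ring B \<Longrightarrow> x \<otimes> y \<in> term_ring B"
    and term_ring_sig: "x \<in> term_ring B \<Longrightarrow> sig K x \<in> term_ring B"
    and term_ring_der: "x \<in> term_ring B \<Longrightarrow> der K x \<in> term_ring B"
proof -
  have I: "tm_vars t = {} \<Longrightarrow> tm_consts t \<subseteq> B \<Longrightarrow> tm_val K (\<lambda>_. \<zero>) t \<in> term_ring B" for t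
    unfolding term_ring_def by blast
  have E: "\<exists>t. tm_vars t = {} \<and> tm_consts t \<subseteq> B \<and> x = tm_val K (\<lambda>_. \<zero>) t" if "x \<in> term_ring B" for x
    using that unfolding term_ring_def by blast
  show "c \<in> B \<Longrightarrow> c \<in> term_ring B"
    using I[of "Const c"] by simp
  show "\<zero> \<in> term_ring B"
    using I[of Zero] by simp
  show "\<one> \<in> term_ring B"
    using I[of One] by simp
  show "x \<oplus> y \<in> term_ring B" if "x \<in> term_ring B" "y \<in> term_ring B"
    using E[OF that(1)] E[OF that(2)] I[of "Add _ _"] by fastforce
  show "x \<ominus> y \<in> term_ring B" if "x \<in> term_ring B" "y \<in> term_ring B"
    using E[OF that(1)] E[OF that(2)] I[of "Sub _ _"] by fastforce
  show "x \<otimes> y \<in> term_ring B" if "x \<in> term_ring B" "y \<in> term_ring B"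
    using E[OF that(1)] E[OF that(2)] I[of "Mul _ _"] by fastforce
  show "sig K x \<in> term_ring B" if "x \<in> term_ring B"
    using E[OF that] I[of "Sig _"] by fastforce
  show "der K x \<in> term_ring B" if "x \<in> term_ring B"
    using E[OF that] I[of "Der _"] by fastforce
qed

lemma term_ring_subset:
  assumes "B \<subseteq> S" "subring S K" "\<And>x. x \<in> S \<Longrightarrow> sig K x \<in> S" "\<And>x. x \<in> S \<Longrightarrow> der K x \<in> S"
  shows "term_ring B \<subseteq> S"
proof -
  note S = subringE[OF assms(2)]
  have "tm_val K (\<lambda>_. \<zero>) t \<in> S" if "tm_vars t = {}" "tm_consts t \<subseteq> B" for t
    using that
  proof (induction t)
    case (Sub s t)
    then have "tm_val K (\<lambda>_. \<zero>) s \<in> S" "\<ominus> tm_val K (\<lambda>_. \<zero>) t \<in> S"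
      using S(5) by auto
    then show ?case using S(7) by (simp add: minus_eq)
  qed (use S assms in auto)
  then show ?thesis
    unfolding term_ring_def by auto
qed

lemma term_ring_subset_dd_generated: "B \<subseteq> carrier K \<Longrightarrow> term_ring B \<subseteq> dd_generated K B"
  using dd_subfieldD[OF dd_subfield_dd_generated] dd_generated_incl by (intro term_ring_subset) auto

lemma term_ring_carrier: "B \<subseteq> carrier K \<Longrightarrow> term_ring B \<subseteq> carrier K"
  using term_ring_subset[of B "carrier K"] carrier_is_subring der_closed by auto

lemma subring_term_ring:
  assumes "B \<subseteq> carrier K"
  shows "subring (term_ring B) K"
proof (intro subringI)
  show "term_ring B \<subseteq> carrier K"
    using term_ring_carrier[OF assms] .
  then show "\<ominus> h \<in> term_ring B" if "h \<in> term_ring B" for h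
    using term_ring_sub[OF term_ring_zero that] that by (auto simp: minus_eq)
qed (fact term_ring_one term_ring_mult term_ring_add)+

lemma term_ring_mono: "B \<subseteq> C \<Longrightarrow> term_ring B \<subseteq> term_ring C"
  unfolding term_ring_def by blast

lemma sig_fractions:
  assumes "B \<subseteq> carrier K" "u \<in> fractions (term_ring B)"
  shows "sig K u \<in> fractions (term_ring B)"
proof -
  obtain t where u: "u \<in> carrier K" "t \<in> term_ring B" "t \<noteq> \<zero>" "u \<otimes> t \<in> term_ring B"
    using assms(2) unfolding fractions_def by blast
  have t: "t \<in> carrier K"
    using u term_ring_carrier[OF assms(1)] by blast
  have "sig K u \<otimes> sig K t \<in> term_ring B"
    using term_ring_sig[OF u(4)] u(1) t by simp
  then show ?thesis
    unfolding fractions_def using u(1) t term_ring_sig[OF u(2)] sig_eq_zero_iff[OF t] u(3) by auto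
qed

lemma der_fractions:
  assumes "B \<subseteq> carrier K" "u \<in> fractions (term_ring B)"
  shows "der K u \<in> fractions (term_ring B)"
proof -
  obtain t where u: "u \<in> carrier K" "t \<in> term_ring B" "t \<noteq> \<zero>" "u \<otimes> t \<in> term_ring B"
    using assms(2) unfolding fractions_def by blast
  have t: "t \<in> carrier K"
    using u term_ring_carrier[OF assms(1)] by blast
  have d: "der K u \<in> carrier K" "der K t \<in> carrier K"
    using der_closed u t by auto
  \<comment> \<open>This is the quotient rule for u with denominator t, multiplied by the square of
    t.\<close>
  have "der K (u \<otimes> t) \<otimes> t \<ominus> (u \<otimes> t) \<otimes> der K t =
      (der K u \<otimes> t \<oplus> u \<otimes> der K t) \<otimes> t \<ominus> (u \<otimes> t) \<otimes> der K t"
    using der_mult u t by simp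
  also have "\<dots> = der K u \<otimes> (t \<otimes> t)"
    using u t d by algebra
  finally have "der K u \<otimes> (t \<otimes> t) \<in> term_ring B"
    using term_ring_sub term_ring_mult term_ring_der u by metis
  moreover have "t \<otimes> t \<in> term_ring B" "t \<otimes> t \<noteq> \<zero>"
    using term_ring_mult u t integral by blast+
  ultimately show ?thesis
    unfolding fractions_def using d by blast
qed

lemma sig_funpow_hom: "(sig K ^^ k) \<in> ring_hom K K"
proof (induction k)
  case 0
  then show ?case by (auto simp: ring_hom_def)
next
  case (Suc k)
  then show ?case
    using ring_hom_trans[OF Suc sg.homh] by (simp add: o_def)
qed

lemma der_sig_funpow: "x \<in> carrier K \<Longrightarrow> der K ((sig K ^^ k) x) = (sig K ^^ k) (der K x)"
proof (induction k)
  case (Suc k)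
  then show ?case
    using sig_der[OF ring_hom_memE(1)[OF sig_funpow_hom Suc.prems], of k] by (simp only: funpow.simps o_def)
qed simp

text \<open>Terms cannot express \<open>\<sigma>\<inverse>\<close>, so an element of the generated field is a fraction of closed
  terms only after applying a power of \<open>\<sigma>\<close>.\<close>

lemma dd_generated_fraction:
  assumes B: "B \<subseteq> carrier K" and "u \<in> dd_generated K B"
  shows "\<exists>k. (sig K ^^ k) u \<in> fractions (term_ring B)"
proof -
  let ?F = "fractions (term_ring B)"
  \<comment> \<open>The exponent k may depend on the element; \<open>?Q\<close> is shown to be a
    difference-differential subfield containing B, hence to contain the generated field.\<close>
  let ?Q = "{u \<in> carrier K. \<exists>k. (sig K ^^ k) u \<in> ?F}"
  have F: "subfield ?F K"
    using subfield_fractions[OF subring_term_ring[OF B]] .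
  note Fr = subringE[OF subfieldE(1)[OF F]]
  \<comment> \<open>Fractions are preserved by \<sigma>, so exponents can be raised and two elements
    brought to a common one.\<close>
  have up: "(sig K ^^ (l + k)) u \<in> ?F" if "(sig K ^^ k) u \<in> ?F" for k l u
    using that sig_fractions[OF B] by (induction l) auto
  note h = ring_hom_memE[OF sig_funpow_hom]
  have "dd_subfield ?Q K"
  proof (intro dd_subfieldI subfieldI' subringI)
    show "\<one> \<in> ?Q"
      using Fr(3) by (auto intro!: exI[of _ 0])
  next
    fix u assume "u \<in> ?Q"
    then obtain k where u: "u \<in> carrier K" "(sig K ^^ k) u \<in> ?F" by blast
    interpret hk: ring_hom_ring K K "sig K ^^ k"
      using sig_funpow_hom ring_axioms by (auto intro!: ring_hom_ringI2)
    show "\<ominus> u \<in> ?Q"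
      using u Fr(5) by (auto intro!: exI[of _ k])
    show "sig K u \<in> ?Q"
      using u sig_fractions[OF B u(2)] by (auto intro!: exI[of _ k] simp: funpow_swap1)
    show "der K u \<in> ?Q"
      using u der_fractions[OF B u(2)] by (auto intro!: exI[of _ k] simp: der_sig_funpow der_closed)
  next
    fix u v assume "u \<in> ?Q" "v \<in> ?Q"
    then obtain k l where u: "u \<in> carrier K" "(sig K ^^ k) u \<in> ?F"
      and v: "v \<in> carrier K" "(sig K ^^ l) v \<in> ?F" by blast
    then have "(sig K ^^ (l + k)) u \<in> ?F" "(sig K ^^ (l + k)) v \<in> ?F"
      using up[of k u l] up[of l v k] by (auto simp: add.commute)
    then show "u \<otimes> v \<in> ?Q" "u \<oplus> v \<in> ?Q"
      using u v h(2,3)[of u v "l + k"] Fr(6,7) by (auto intro!: exI[of _ "l + k"])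
  next
    fix u assume "u \<in> ?Q - {\<zero>}"
    then obtain k where u: "u \<in> carrier K" "u \<noteq> \<zero>" "(sig K ^^ k) u \<in> ?F" by blast
    have i: "inv u \<in> carrier K" "inv u \<otimes> u = \<one>" "u \<otimes> inv u = \<one>"
      using u field_Units by auto
    have "(sig K ^^ k) u \<otimes> (sig K ^^ k) (inv u) = \<one>"
      using h(2)[of u "inv u" k] h(4) u i by simp
    moreover have "(sig K ^^ k) u \<noteq> \<zero>"
      using calculation h(1)[OF i(1)] by auto
    ultimately have "(sig K ^^ k) (inv u) \<in> ?F"
      using subfield_m_inv_simprule[OF F, of "(sig K ^^ k) u" "(sig K ^^ k) (inv u)"] u Fr(3) h(1)[OF i(1)]
      by auto
    then show "inv u \<in> ?Q"
      using i by blast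
  next
    \<comment> \<open>Closure under the inverse of \<sigma> costs one more application of \<sigma>,
      which the free exponent absorbs.\<close>
    fix u assume "u \<in> carrier K" "sig K u \<in> ?Q"
    then obtain k where "(sig K ^^ Suc k) u \<in> ?F"
      by (auto simp: funpow_swap1)
    then show "u \<in> ?Q"
      using \<open>u \<in> carrier K\<close> by blast
  qed auto
  moreover have "B \<subseteq> ?Q"
  proof
    fix b assume b: "b \<in> B"
    have "(sig K ^^ 0) b \<in> ?F"
      using subset_fractions[OF subring_term_ring[OF B]] term_ring_const[OF b] by auto
    then show "b \<in> ?Q"
      using b B by blast
  qed
  ultimately show ?thesis
    using dd_generated_minimal assms(2) by blast
qed

text \<open>A sufficiently high power of \<sigma>, applied to an equation for z over the generated
  field, turns all coefficients into fractions of closed terms while z stays in place; then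
  denominators are cleared.\<close>

lemma fixed_acl_imp_alg_over:
  assumes B: "B \<subseteq> carrier K" and "z \<in> acl K B" "sig K z = z"
  shows "alg_over (term_ring B) z"
proof -
  let ?F = "fractions (term_ring B)"
  have common: "\<exists>k. \<forall>c \<in> set p. (sig K ^^ k) c \<in> ?F" if "set p \<subseteq> dd_generated K B" for p
    using that
  proof (induction p)
    case (Cons a p)
    then obtain k l where kl: "(sig K ^^ k) a \<in> ?F" "\<And>c. c \<in> set p \<Longrightarrow> (sig K ^^ l) c \<in> ?F"
      using dd_generated_fraction[OF B] by auto meson
    have up: "(sig K ^^ (i + j)) u \<in> ?F" if "(sig K ^^ j) u \<in> ?F" for i j u
      using that sig_fractions[OF B] by (induction i) auto
    have "\<forall>c \<in> set (a # p). (sig K ^^ (k + l)) c \<in> ?F"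
      using up[OF kl(1), of l] up[OF kl(2), of _ k] by (auto simp: add.commute)
    then show ?case by blast
  qed simp
  obtain p where z: "z \<in> carrier K" and
    p: "set p \<subseteq> dd_generated K B" "\<not> set p \<subseteq> {\<zero>}" "eval p z = \<zero>"
    using assms(2) unfolding acl_iff[OF B] alg_over_def by blast
  have pK: "set p \<subseteq> carrier K"
    using p dd_subfieldD(3)[OF dd_subfield_dd_generated[OF B]] by blast
  obtain k where k: "\<forall>c \<in> set p. (sig K ^^ k) c \<in> ?F"
    using common[OF p(1)] by blast
  interpret hk: ring_hom_ring K K "sig K ^^ k"
    using sig_funpow_hom ring_axioms by (auto intro!: ring_hom_ringI2)
  have "(sig K ^^ k) z = z"
    using assms(3) by (induction k) auto
  then have "eval (map (sig K ^^ k) p) z = \<zero>"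
    using hk.eval_hom'[OF z pK] p(3) by simp
  moreover have "set (map (sig K ^^ k) p) \<subseteq> ?F"
    using k by auto
  moreover have "(sig K ^^ j) c = \<zero> \<longleftrightarrow> c = \<zero>" if "c \<in> carrier K" for c j
    using that by (induction j) (auto simp: sig_eq_zero_iff ring_hom_memE(1)[OF sig_funpow_hom])
  then have "\<not> set (map (sig K ^^ k) p) \<subseteq> {\<zero>}"
    using p(2) pK by (auto simp: image_subset_iff subset_iff)
  ultimately have "alg_over ?F z"
    unfolding alg_over_def by blast
  then show ?thesis
    using alg_over_fractions[OF subring_term_ring[OF B] z] by blast
qed

section \<open>Exchange for constants fixed by \<sigma>\<close>

definition fixed_consts :: "'a set" where
  "fixed_consts = {x \<in> carrier K. sig K x = x \<and> der K x = \<zero>}"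

text \<open>As \<sigma> fixes y and D kills it, both act on a polynomial in y through its
  coefficients; the polynomials in y over \<open>term_ring B\<close> are therefore already closed
  under \<sigma> and D.\<close>

lemma term_ring_insert_fixed:
  assumes B: "B \<subseteq> carrier K" and y: "y \<in> fixed_consts"
  shows "term_ring (insert y B) \<subseteq> simple_extension (term_ring B) y"
proof (rule term_ring_subset)
  let ?S = "term_ring B"
  note S = subring_term_ring[OF B] and SK = term_ring_carrier[OF B]
  have yK: "y \<in> carrier K" "sig K y = y" "der K y = \<zero>"
    using y unfolding fixed_consts_def by auto
  show "insert y B \<subseteq> simple_extension ?S y"
    using simple_extension_mem[OF S yK(1)] simple_extension_incl[OF SK yK(1)] term_ring_const by blast
  show "subring (simple_extension ?S y) K"
    using simple_extension_is_subring[OF S yK(1)] .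
  have EK: "simple_extension ?S y \<subseteq> carrier K"
    using simple_extension_in_carrier[OF SK yK(1)] .
  fix x assume "x \<in> simple_extension ?S y"
  then show "sig K x \<in> simple_extension ?S y"
  proof (induction rule: simple_extension.induct)
    case (lin k1 k2)
    then have "k1 \<in> carrier K" "k2 \<in> carrier K"
      using EK SK by auto
    then have "sig K (k1 \<otimes> y \<oplus> k2) = sig K k1 \<otimes> y \<oplus> sig K k2"
      using yK by simp
    then show ?case
      using simple_extension.lin[OF lin.IH] term_ring_sig lin by simp
  qed simp
  show "der K x \<in> simple_extension ?S y"
    using \<open>x \<in> simple_extension ?S y\<close>
  proof (induction rule: simple_extension.induct)
    case (lin k1 k2)
    then have "k1 \<in> carrier K" "k2 \<in> carrier K"
      using EK SK by auto
    then have "der K (k1 \<otimes> y \<oplus> k2) = der K k1 \<otimes> y \<oplus> der K k2"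
      using yK by (simp add: der_add der_mult der_closed)
    then show ?case
      using simple_extension.lin[OF lin.IH] term_ring_der lin by simp
  qed (simp add: der_zero)
qed

text \<open>For z fixed by \<sigma>, lying in \<open>acl\<close> is algebraicity over a ring of
  closed terms, and adjoining y to that ring gives only polynomials in y. What remains is a
  polynomial relation between y and z.\<close>

lemma acl_exchange:
  assumes B: "B \<subseteq> carrier K" and y: "y \<in> fixed_consts" and z: "z \<in> fixed_consts"
    and "z \<in> acl K (insert y B)" "z \<notin> acl K B"
  shows "y \<in> acl K (insert z B)"
proof -
  have yz: "y \<in> carrier K" "z \<in> carrier K" "sig K z = z"
    using y z unfolding fixed_consts_def by auto
  then have ins: "insert y B \<subseteq> carrier K" "insert z B \<subseteq> carrier K"
    using B by auto
  have "alg_over (simple_extension (term_ring B) y) z"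
    using fixed_acl_imp_alg_over[OF ins(1) assms(4) yz(3)] term_ring_insert_fixed[OF B y]
    unfolding alg_over_def by blast
  moreover have "\<not> alg_over (term_ring B) z"
    using assms(5) term_ring_subset_dd_generated[OF B] yz unfolding acl_iff[OF B] alg_over_def by blast
  ultimately have "alg_over (term_ring (insert z B)) y"
    using alg_over_exchange[of "term_ring B" "term_ring (insert z B)" y z]
      subring_term_ring[OF B] subring_term_ring[OF ins(2)] term_ring_mono[of B "insert z B"]
      term_ring_const[of z "insert z B"] yz by blast
  then show ?thesis
    using term_ring_subset_dd_generated[OF ins(2)] yz unfolding acl_iff[OF ins(2)] alg_over_def by blast
qed

end

section \<open>Formulas for scaling and for transcendence\<close>

primrec tm_pow :: "nat \<Rightarrow> 'a dd_tm" where
  "tm_pow 0 = One"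
| "tm_pow (Suc k) = Mul (tm_pow k) (Var 0)"

text \<open>The syntactic counterpart of \<open>eval\<close>, with the same order of coefficients
  and \<open>Var 0\<close> as the unknown.\<close>

primrec tm_poly :: "'a dd_tm list \<Rightarrow> 'a dd_tm" where
  "tm_poly [] = Zero"
| "tm_poly (t # ts) = Add (Mul t (tm_pow (length ts))) (tm_poly ts)"

lemma tm_pow_simps [simp]: "tm_vars (tm_pow k) \<subseteq> {0}" "tm_consts (tm_pow k) = {}"
  by (induction k) auto

lemma tm_vars_tm_poly: "(\<And>t. t \<in> set ts \<Longrightarrow> tm_vars t = {}) \<Longrightarrow> tm_vars (tm_poly ts) \<subseteq> {0}"
  using tm_pow_simps(1) by (induction ts) auto

lemma tm_consts_tm_poly: "tm_consts (tm_poly ts) = (\<Union>t\<in>set ts. tm_consts t)"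
  by (induction ts) auto

lemma tm_val_tm_pow: "tm_val K (\<lambda>_. x) (tm_pow k) = x [^]\<^bsub>K\<^esub> k"
  by (induction k) auto

lemma (in dd_field) tm_val_tm_poly:
  "tm_val K (\<lambda>_. x) (tm_poly ts) = eval (map (tm_val K (\<lambda>_. x)) ts) x"
  by (induction ts) (auto simp: tm_val_tm_pow)

primrec exs :: "nat \<Rightarrow> 'a dd_fm \<Rightarrow> 'a dd_fm" where
  "exs 0 \<phi> = \<phi>"
| "exs (Suc k) \<phi> = Ex k (exs k \<phi>)"

lemma free_vars_exs: "free_vars (exs k \<phi>) = free_vars \<phi> - {..<k}"
proof (induction k)
  case (Suc k)
  then show ?case by (simp add: lessThan_Suc) blast
qed simp

lemma fm_consts_exs: "fm_consts (exs k \<phi>) = fm_consts \<phi>"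
  by (induction k) auto

lemma sat_exs:
  "sat K v (exs k \<phi>) \<longleftrightarrow> (\<exists>f. (\<forall>i<k. f i \<in> carrier K) \<and> sat K (\<lambda>i. if i < k then f i else v i) \<phi>)"
proof (induction k arbitrary: v)
  case 0
  then show ?case by simp
next
  case (Suc k)
  show ?case
  proof
    assume "sat K v (exs (Suc k) \<phi>)"
    then obtain x f where x: "x \<in> carrier K" "\<forall>i<k. f i \<in> carrier K"
      "sat K (\<lambda>i. if i < k then f i else (v(k := x)) i) \<phi>"
      using Suc by auto
    moreover have "(\<lambda>i. if i < k then f i else (v(k := x)) i) = (\<lambda>i. if i < Suc k then (f(k := x)) i else v i)"
      by (auto simp: fun_eq_iff)
    ultimately show "\<exists>f. (\<forall>i<Suc k. f i \<in> carrier K) \<and> sat K (\<lambda>i. if i < Suc k then f i else v i) \<phi>"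
      by (intro exI[of _ "f(k := x)"]) (auto simp: less_Suc_eq)
  next
    assume "\<exists>f. (\<forall>i<Suc k. f i \<in> carrier K) \<and> sat K (\<lambda>i. if i < Suc k then f i else v i) \<phi>"
    then obtain f where f: "\<forall>i<Suc k. f i \<in> carrier K" "sat K (\<lambda>i. if i < Suc k then f i else v i) \<phi>"
      by blast
    moreover have "(\<lambda>i. if i < Suc k then f i else v i) = (\<lambda>i. if i < k then f i else (v(k := f k)) i)"
      by (auto simp: fun_eq_iff less_Suc_eq)
    ultimately have "sat K (v(k := f k)) (exs k \<phi>)"
      unfolding Suc by (intro exI[of _ f]) auto
    then show "sat K v (exs (Suc k) \<phi>)"
      using f(1) by auto
  qed
qed

primrec coord_eqs :: "nat \<Rightarrow> (nat \<Rightarrow> 'a) \<Rightarrow> nat \<Rightarrow> 'a dd_fm" where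
  "coord_eqs n h 0 = Eq Zero Zero"
| "coord_eqs n h (Suc j) = Conj (coord_eqs n h j) (Eq (Var j) (Mul (Var n) (Const (h j))))"

lemma coord_eqs_props:
  "sat K v (coord_eqs n h k) \<longleftrightarrow> (\<forall>j<k. v j = v n \<otimes>\<^bsub>K\<^esub> h j)"
  "free_vars (coord_eqs n h k) \<subseteq> insert n {..<k}"
  "fm_consts (coord_eqs n h k) = h ` {..<k}"
  by (induction k) (auto simp: less_Suc_eq lessThan_Suc)

text \<open>The variable \<open>0\<close> is first copied to \<open>n\<close>, since \<open>\<phi>\<close> may use all of \<open>0, \<dots>, n - 1\<close>.\<close>

definition scale_fm :: "nat \<Rightarrow> (nat \<Rightarrow> 'a) \<Rightarrow> 'a dd_fm \<Rightarrow> 'a dd_fm" where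
  "scale_fm n h \<phi> = Ex n (Conj (Eq (Var n) (Var 0)) (exs n (Conj (coord_eqs n h n) \<phi>)))"

definition scale :: "'a dd_ring \<Rightarrow> nat \<Rightarrow> 'a \<Rightarrow> (nat \<Rightarrow> 'a) \<Rightarrow> nat \<Rightarrow> 'a" where
  "scale K n x h = (\<lambda>j\<in>{..<n}. x \<otimes>\<^bsub>K\<^esub> h j)"

context dd_field
begin

lemma scale_PiE:
  "x \<in> carrier K \<Longrightarrow> h \<in> {..<n} \<rightarrow>\<^sub>E carrier K \<Longrightarrow> scale K n x h \<in> {..<n} \<rightarrow>\<^sub>E carrier K"
  unfolding scale_def by auto

text \<open>The coordinate equations force the quantified variables to be the entries of the scaled
  vector, and \<phi> depends on no others.\<close>

lemma sat_scale_fm: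
  assumes "n > 0" "x \<in> carrier K" "h \<in> {..<n} \<rightarrow>\<^sub>E carrier K" "free_vars \<phi> \<subseteq> {..<n}"
  shows "sat K (\<lambda>_. x) (scale_fm n h \<phi>) \<longleftrightarrow> sat K (scale K n x h) \<phi>"
proof
  assume "sat K (\<lambda>_. x) (scale_fm n h \<phi>)"
  then obtain f where f: "\<And>j. j < n \<Longrightarrow> f j = x \<otimes> h j" "sat K (\<lambda>i. if i < n then f i else x) \<phi>"
    using assms(1) unfolding scale_fm_def
    by (auto simp: sat_exs coord_eqs_props fun_upd_def cong: if_cong)
  have "sat K (\<lambda>i. if i < n then f i else x) \<phi> \<longleftrightarrow> sat K (scale K n x h) \<phi>"
    using assms(4) f(1) by (intro sat_cong) (auto simp: scale_def)
  then show "sat K (scale K n x h) \<phi>"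
    using f(2) by blast
next
  assume s: "sat K (scale K n x h) \<phi>"
  have "sat K (\<lambda>i. if i < n then scale K n x h i else x) \<phi> \<longleftrightarrow> sat K (scale K n x h) \<phi>"
    using assms(4) by (intro sat_cong) auto
  then have s': "sat K (\<lambda>i. if i < n then scale K n x h i else x) \<phi>"
    using s by blast
  have "\<forall>i<n. scale K n x h i \<in> carrier K"
    using scale_PiE[OF assms(2,3)] by auto
  moreover have "(\<lambda>i. if i < n then scale K n x h i else ((\<lambda>_. x)(n := x)) i) =
      (\<lambda>i. if i < n then scale K n x h i else x)"
    by auto
  ultimately have "sat K ((\<lambda>_. x)(n := x)) (exs n (Conj (coord_eqs n h n) \<phi>))"
    unfolding sat_exs using s' by (intro exI[of _ "scale K n x h"]) (auto simp: coord_eqs_props scale_def)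
  then show "sat K (\<lambda>_. x) (scale_fm n h \<phi>)"
    unfolding scale_fm_def using assms(1,2) by (auto intro!: bexI[of _ x])
qed

lemma scale_fm_vars: "free_vars \<phi> \<subseteq> {..<n} \<Longrightarrow> free_vars (scale_fm n h \<phi>) \<subseteq> {0}"
  using coord_eqs_props(2)[of n h n] unfolding scale_fm_def by (auto simp: free_vars_exs)

lemma scale_fm_consts: "fm_consts (scale_fm n h \<phi>) = h ` {..<n} \<union> fm_consts \<phi>"
  unfolding scale_fm_def by (simp add: fm_consts_exs coord_eqs_props)

section \<open>Generic multipliers\<close>

lemma nat_fixed_consts: "[(k::nat)] \<cdot> \<one> \<in> fixed_consts"
proof -
  have "sig K ([k] \<cdot> \<one>) = [k] \<cdot> \<one>"
    by (induction k) auto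
  moreover have "der K ([k] \<cdot> \<one>) = [k] \<cdot> \<zero>"
    using der_nat_mult[of \<one> k] der_one by simp
  moreover have "[k] \<cdot> \<zero> = \<zero>"
    by (induction k) auto
  ultimately show ?thesis
    unfolding fixed_consts_def by simp
qed

lemma inj_nat: "inj (\<lambda>k::nat. [k] \<cdot> \<one>)"
proof -
  have "k = l" if "[k] \<cdot> \<one> = [l] \<cdot> \<one>" "k \<le> l" for k l :: nat
  proof -
    have "[(l - k)] \<cdot> \<one> \<oplus> [k] \<cdot> \<one> = [l] \<cdot> \<one>"
      using add.nat_pow_mult[of \<one> "l - k" k] that(2) by simp
    then have "[(l - k)] \<cdot> \<one> = \<zero>"
      using that(1) by (simp add: add.r_cancel_one)
    then show ?thesis
      using char_0[of "l - k"] that(2) by fastforce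
  qed
  then show ?thesis
    unfolding inj_def by (metis nat_le_linear)
qed

lemma infinite_carrier: "infinite (carrier K)"
  using range_inj_infinite[OF inj_nat] finite_subset[of "range (\<lambda>k::nat. [k] \<cdot> \<one>)" "carrier K"] by auto

text \<open>A natural multiple of h is a repeated sum. These multiples are the points at which the
  conditions on a multiplier are tested.\<close>

lemma scale_nat_mem:
  assumes "subgroup H (Ga_pow K n)" "h \<in> H"
  shows "scale K n ([(k::nat)] \<cdot> \<one>) h \<in> H"
proof -
  have h: "h j \<in> carrier K" if "j < n" for j
    using subgroup.subset[OF assms(1)] assms(2) that by (auto simp: PiE_def Pi_def)
  show ?thesis
  proof (induction k)
    case 0
    have "scale K n ([(0::nat)] \<cdot> \<one>) h = \<one>\<^bsub>Ga_pow K n\<^esub>"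
      unfolding scale_def one_product_group by (rule restrict_ext) (simp add: h)
    then show ?case
      using subgroup.one_closed[OF assms(1)] by (simp only:)
  next
    case (Suc k)
    have "scale K n ([Suc k] \<cdot> \<one>) h = scale K n ([k] \<cdot> \<one>) h \<otimes>\<^bsub>Ga_pow K n\<^esub> h"
      unfolding scale_def mult_product_group by (rule restrict_ext) (simp add: h l_distr)
    then show ?case
      using subgroup.m_closed[OF assms(1) Suc assms(2)] by (simp only:)
  qed
qed

text \<open>Keeps the parameter set within the bound of saturation when finitely many coordinates
  and multipliers are added: an infinite A absorbs them, and a finite union is smaller than the
  infinite carrier.\<close>

lemma lesspoll_Un_finite:
  assumes "A \<prec> carrier K" "finite Y"
  shows "A \<union> Y \<prec> carrier K"
proof (cases "finite A")
  case True
  then show ?thesis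
    using finite_lesspoll_infinite[OF infinite_carrier, of "A \<union> Y"] assms(2) by simp
next
  case False
  from assms(2) have "A \<union> Y \<approx> A"
  proof induction
    case (insert y Y)
    then have "insert y (A \<union> Y) \<approx> A \<union> Y"
      using infinite_insert_eqpoll[of "A \<union> Y" y] False by simp
    then show ?case
      using insert eqpoll_trans by auto
  qed simp
  then show ?thesis
    using eq_lesspoll_trans assms(1) by blast
qed

text \<open>The integers satisfy all but finitely many of the conditions, so the conditions are finitely
  satisfiable.\<close>

lemma exists_generic_multiplier:
  assumes "saturated K" "A \<subseteq> carrier K" "A \<prec> carrier K" "definable K A n H"
    and H: "subgroup H (Ga_pow K n)" and "n > 0"
    and "finite P" "P \<subseteq> H" "finite Y" "Y \<subseteq> carrier K"
  obtains x where "x \<in> fixed_consts" "\<forall>h \<in> P. scale K n x h \<in> H" "x \<notin> acl K (A \<union> Y)"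
proof -
  obtain \<phi> where \<phi>: "fm_consts \<phi> \<subseteq> A" "free_vars \<phi> \<subseteq> {..<n}"
    and H_eq: "H = {x \<in> {..<n} \<rightarrow>\<^sub>E carrier K. sat K x \<phi>}"
    using assms(4) unfolding definable_def by blast
  have P: "P \<subseteq> {..<n} \<rightarrow>\<^sub>E carrier K"
    using assms(8) H_eq by blast
  have scale_iff: "sat K (\<lambda>_. x) (scale_fm n h \<phi>) \<longleftrightarrow> scale K n x h \<in> H"
    if "x \<in> carrier K" "h \<in> P" for x h
    using sat_scale_fm[OF assms(6) that(1) _ \<phi>(2), of h] scale_PiE[OF that(1), of h n] P that(2)
    unfolding H_eq by blast
  \<comment> \<open>The coordinates of the vectors in P occur as constants in the scaling
    formulas.\<close>
  define Z where "Z = Y \<union> (\<Union>h\<in>P. h ` {..<n})"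
  have Z: "finite Z" "Z \<subseteq> carrier K"
    unfolding Z_def using assms P by (auto simp: PiE_def Pi_def)
  let ?B = "A \<union> Z"
  have B: "?B \<subseteq> carrier K" "?B \<prec> carrier K"
    using assms(2) Z lesspoll_Un_finite[OF assms(3)] by auto
  \<comment> \<open>Each list in \<open>TS\<close> names a polynomial over
    \<open>term_ring ?B\<close> with some nonzero coefficient; the inequations for all of them
    together say that x is transcendental over this ring.\<close>
  define TS where "TS = {ts. (\<forall>t \<in> set ts. tm_vars t = {} \<and> tm_consts t \<subseteq> ?B) \<and>
    \<not> tm_val K (\<lambda>_. \<zero>) ` set ts \<subseteq> {\<zero>}}"
  define \<Phi> where "\<Phi> = {Eq (Sig (Var 0)) (Var 0), Eq (Der (Var 0)) Zero} \<union>
    (\<lambda>h. scale_fm n h \<phi>) ` P \<union> (\<lambda>ts. Neg (Eq (tm_poly ts) Zero)) ` TS"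
  have poly_val: "tm_val K (\<lambda>_. x) (tm_poly ts) = eval (map (tm_val K (\<lambda>_. \<zero>)) ts) x"
    if "ts \<in> TS" for x ts
  proof -
    have "tm_val K (\<lambda>_. x) t = tm_val K (\<lambda>_. \<zero>) t" if "t \<in> set ts" for t
      using that \<open>ts \<in> TS\<close> unfolding TS_def by (intro tm_val_cong) auto
    then have "map (tm_val K (\<lambda>_. x)) ts = map (tm_val K (\<lambda>_. \<zero>)) ts" by simp
    then show ?thesis
      using tm_val_tm_poly by metis
  qed
  have closed_fms: "\<forall>\<psi> \<in> \<Phi>. free_vars \<psi> \<subseteq> {0} \<and> fm_consts \<psi> \<subseteq> ?B"
  proof
    fix \<psi> assume "\<psi> \<in> \<Phi>"
    then consider "\<psi> = Eq (Sig (Var 0)) (Var 0)" | "\<psi> = Eq (Der (Var 0)) Zero"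
      | h where "h \<in> P" "\<psi> = scale_fm n h \<phi>" | ts where "ts \<in> TS" "\<psi> = Neg (Eq (tm_poly ts) Zero)"
      unfolding \<Phi>_def by blast
    then show "free_vars \<psi> \<subseteq> {0} \<and> fm_consts \<psi> \<subseteq> ?B"
    proof cases
      case 3
      then have "h ` {..<n} \<subseteq> Z"
        unfolding Z_def by blast
      then show ?thesis
        using scale_fm_vars[OF \<phi>(2), of h] \<phi>(1) 3 by (auto simp: scale_fm_consts)
    next
      case 4
      then show ?thesis
        using tm_vars_tm_poly[of ts] unfolding TS_def by (auto simp: tm_consts_tm_poly)
    qed auto
  qed
  \<comment> \<open>Only the inequations can fail at a natural number, and each fails just at the
    finitely many that are roots of its polynomial.\<close>
  have cofinite: "finite {k. \<not> sat K (\<lambda>_. [(k::nat)] \<cdot> \<one>) \<psi>}" if "\<psi> \<in> \<Phi>" for \<psi>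
  proof -
    note c = nat_fixed_consts[unfolded fixed_consts_def]
    from that consider "\<psi> = Eq (Sig (Var 0)) (Var 0)" | "\<psi> = Eq (Der (Var 0)) Zero"
      | h where "h \<in> P" "\<psi> = scale_fm n h \<phi>" | ts where "ts \<in> TS" "\<psi> = Neg (Eq (tm_poly ts) Zero)"
      unfolding \<Phi>_def by blast
    then show ?thesis
    proof cases
      case 3
      then show ?thesis
        using scale_iff scale_nat_mem[OF H] assms(8) by (simp add: subset_iff)
    next
      case 4
      let ?p = "map (tm_val K (\<lambda>_. \<zero>)) ts"
      have "set ?p \<subseteq> term_ring ?B"
        using 4(1) unfolding TS_def term_ring_def by auto
      then have "finite {x \<in> carrier K. eval ?p x = \<zero>}"
        using 4(1) term_ring_carrier[OF B(1)] unfolding TS_def by (intro finite_roots_list) auto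
      then have "finite ((\<lambda>k::nat. [k] \<cdot> \<one>) -` {x \<in> carrier K. eval ?p x = \<zero>})"
        using inj_nat by (rule finite_vimageI)
      then show ?thesis
        using 4 poly_val[OF 4(1)] by (simp add: vimage_def)
    qed (use c in auto)
  qed
  have "\<forall>\<Phi>\<^sub>0 \<subseteq> \<Phi>. finite \<Phi>\<^sub>0 \<longrightarrow> (\<exists>x \<in> carrier K. \<forall>\<psi> \<in> \<Phi>\<^sub>0. sat K (\<lambda>_. x) \<psi>)"
  proof (intro allI impI)
    fix \<Phi>\<^sub>0 assume \<Phi>\<^sub>0: "\<Phi>\<^sub>0 \<subseteq> \<Phi>" "finite \<Phi>\<^sub>0"
    then have "finite (\<Union>\<psi>\<in>\<Phi>\<^sub>0. {k. \<not> sat K (\<lambda>_. [(k::nat)] \<cdot> \<one>) \<psi>})"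
      using cofinite by blast
    then obtain k where "k \<notin> (\<Union>\<psi>\<in>\<Phi>\<^sub>0. {k. \<not> sat K (\<lambda>_. [(k::nat)] \<cdot> \<one>) \<psi>})"
      using ex_new_if_finite infinite_UNIV_nat by blast
    then show "\<exists>x \<in> carrier K. \<forall>\<psi> \<in> \<Phi>\<^sub>0. sat K (\<lambda>_. x) \<psi>"
      by (intro bexI[of _ "[k] \<cdot> \<one>"]) auto
  qed
  then obtain x where x: "x \<in> carrier K" "\<forall>\<psi> \<in> \<Phi>. sat K (\<lambda>_. x) \<psi>"
    using assms(1)[unfolded saturated_def, rule_format, OF B closed_fms[rule_format]] by blast
  have xF: "x \<in> fixed_consts"
    using x unfolding fixed_consts_def \<Phi>_def by auto
  moreover have "scale K n x h \<in> H" if "h \<in> P" for h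
    using x scale_iff[OF x(1) that] that unfolding \<Phi>_def by blast
  moreover have "x \<notin> acl K (A \<union> Y)"
  proof
    assume "x \<in> acl K (A \<union> Y)"
    then have "x \<in> acl K ?B"
      using acl_mono[OF B(1), of "A \<union> Y"] unfolding Z_def by blast
    \<comment> \<open>Because x is fixed by \<sigma>, its equation can be taken with values of
      closed terms as coefficients, and such an equation is excluded by a formula in
      \<open>\<Phi>\<close>.\<close>
    then obtain p where p: "set p \<subseteq> term_ring ?B" "\<not> set p \<subseteq> {\<zero>}" "eval p x = \<zero>"
      using fixed_acl_imp_alg_over[OF B(1)] xF unfolding fixed_consts_def alg_over_def by blast
    then have "p \<in> lists (tm_val K (\<lambda>_. \<zero>) ` {t. tm_vars t = {} \<and> tm_consts t \<subseteq> ?B})"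
      unfolding term_ring_def by auto
    then obtain ts where ts: "p = map (tm_val K (\<lambda>_. \<zero>)) ts" "set ts \<subseteq> {t. tm_vars t = {} \<and> tm_consts t \<subseteq> ?B}"
      unfolding lists_image by auto
    then have "ts \<in> TS"
      using p(2) unfolding TS_def by auto
    then have "sat K (\<lambda>_. x) (Neg (Eq (tm_poly ts) Zero))"
      using x(2) unfolding \<Phi>_def by blast
    then show False
      using poly_val[OF \<open>ts \<in> TS\<close>, of x] p(3) ts(1) by simp
  qed
  ultimately show ?thesis
    using that by blast
qed

end

section \<open>Failure of 1-basedness\<close>

definition scaled_triple :: "'a dd_ring \<Rightarrow> nat \<Rightarrow> (nat \<Rightarrow> 'a) \<Rightarrow> 'a \<Rightarrow> 'a \<Rightarrow> nat \<Rightarrow> nat \<Rightarrow> 'a" where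
  "scaled_triple K n h u v = (\<lambda>i\<in>{..<3}. [h, scale K n u h, scale K n v h] ! i)"

lemma scaled_triple_PiE:
  "h \<in> H \<Longrightarrow> scale K n u h \<in> H \<Longrightarrow> scale K n v h \<in> H \<Longrightarrow> scaled_triple K n h u v \<in> {..<3} \<rightarrow>\<^sub>E H"
  unfolding scaled_triple_def by (auto simp: less_Suc_eq numeral_3_eq_3)

lemma coords_scaled_triple:
  "coords n 3 (scaled_triple K n h u v) =
    (\<Union>j<n. {h j, u \<otimes>\<^bsub>K\<^esub> h j, v \<otimes>\<^bsub>K\<^esub> h j})"
proof -
  have "scaled_triple K n h u v 0 = h" "scaled_triple K n h u v 1 = scale K n u h"
    "scaled_triple K n h u v 2 = scale K n v h"
    unfolding scaled_triple_def by simp_all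
  moreover have "coords n 3 t = (\<Union>j<n. {t 0 j, t 1 j, t 2 j})" for t :: "nat \<Rightarrow> nat \<Rightarrow> 'a"
  proof -
    have "coords n 3 t = (\<Union>j<n. (\<lambda>i. t i j) ` {..<3})"
      unfolding coords_def by blast
    then show ?thesis
      by (simp add: numeral_3_eq_3 numeral_2_eq_2 lessThan_Suc insert_commute)
  qed
  ultimately show ?thesis
    by (simp add: scale_def)
qed

context dd_field
begin

text \<open>The entries of the triple are products of u and v with coordinates of h, so what is
  generic over u, v and h is generic over the triple.\<close>

lemma coords_scaled_triple_subset_acl:
  assumes "A \<subseteq> carrier K" "h ` {..<n} \<subseteq> carrier K" "u \<in> carrier K" "v \<in> carrier K"
  shows "acl K (A \<union> coords n 3 (scaled_triple K n h u v)) \<subseteq> acl K (insert u (insert v (A \<union> h ` {..<n})))"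
proof (rule acl_minimal)
  let ?B = "insert u (insert v (A \<union> h ` {..<n}))"
  show B: "?B \<subseteq> carrier K"
    using assms by auto
  note S = subringE[OF subfieldE(1)[OF subfield_acl[OF B]]]
  have "?B \<subseteq> acl K ?B"
    using subset_acl[OF B] .
  then show "A \<union> coords n 3 (scaled_triple K n h u v) \<subseteq> acl K ?B"
    unfolding coords_scaled_triple using S(6) by auto
qed

text \<open>Dividing by the nonzero coordinate \<open>h j\<close> recovers u and v; for this reason
  h itself belongs to the triple.\<close>

lemma multipliers_mem_acl:
  assumes "C \<subseteq> carrier K" "u \<in> carrier K" "v \<in> carrier K"
    and "coords n 3 (scaled_triple K n h u v) \<subseteq> C" "j < n" "h j \<noteq> \<zero>"
  shows "u \<in> acl K C" "v \<in> acl K C"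
proof -
  have "{h j, u \<otimes> h j, v \<otimes> h j} \<subseteq> acl K C"
    using assms(4,5) subset_acl[OF assms(1)] unfolding coords_scaled_triple by auto
  moreover from this have "h j \<in> carrier K"
    using acl_carrier by blast
  ultimately have "h j \<in> acl K C - {\<zero>}" "h j \<otimes> u \<in> acl K C" "h j \<otimes> v \<in> acl K C"
    using assms(2,3,6) m_comm[of "h j"] by auto
  then show "u \<in> acl K C" "v \<in> acl K C"
    using subfield_m_inv_simprule[OF subfield_acl[OF assms(1)]] assms(2,3) by blast+
qed

text \<open>By linear disjointness \<open>\<one>, m, c\<close> satisfy a linear relation over the common part \<open>E\<close>. If it is
  proportional to \<open>y = m x + c\<close>, then \<open>x \<in> E\<close>; otherwise the two relations determine \<open>m\<close>.\<close>

lemma line_relation_not_linearly_disjoint: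
  assumes "subfield E K" "subfield La K" "subfield Lb K" "subfield L K" "subfield M K"
    and "E \<subseteq> La" "E \<subseteq> Lb" "{m, c} \<subseteq> M" "{x, y} \<subseteq> L" "{x, y} \<subseteq> Lb"
    and "y = m \<otimes> x \<oplus> c" "x \<notin> La" "m \<notin> Lb"
  shows "\<exists>us. set us \<subseteq> M \<and> independent E us \<and> \<not> independent L us"
proof -
  note K = subfieldE(3)[OF assms(2)] subfieldE(3)[OF assms(3)]
  have car: "m \<in> carrier K" "c \<in> carrier K" "x \<in> carrier K" "y \<in> carrier K"
    using assms(8,9) subfieldE(3)[OF assms(4)] subfieldE(3)[OF assms(5)] by auto
  note La = subringE[OF subfieldE(1)[OF assms(2)]] and Lb = subringE[OF subfieldE(1)[OF assms(3)]]
    and L = subringE[OF subfieldE(1)[OF assms(4)]] and M = subringE[OF subfieldE(1)[OF assms(5)]]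
  let ?us = "[\<one>, m, c]"
  have us: "set ?us \<subseteq> M" "set ?us \<subseteq> carrier K"
    using M(3) assms(8) car by auto
  \<comment> \<open>The equation of the line, read as a relation between \<open>\<one>\<close>, m
    and c whose coefficients come from the point.\<close>
  have "combine [y, \<ominus> x, \<ominus> \<one>] ?us = y \<oplus> (\<ominus> x \<otimes> m \<oplus> \<ominus> \<one> \<otimes> c)"
    using car by simp
  also have "\<dots> = \<zero>"
    unfolding assms(11) using car by algebra
  finally have "\<not> independent L ?us"
    using non_trivial_combine_imp_dependent[OF assms(4), of "[y, \<ominus> x, \<ominus> \<one>]" ?us] assms(9) L(3,5) by auto
  moreover have "independent E ?us"
  proof (rule ccontr)
    assume "\<not> independent E ?us"
    then obtain ks where ks: "length ks = length ?us" "combine ks ?us = \<zero>" "set ks \<subseteq> E" "set ks \<noteq> {\<zero>}"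
      using dependent_imp_non_trivial_combine[OF assms(1) us(2)] by blast
    then obtain \<alpha> \<beta> \<gamma> where k: "ks = [\<alpha>, \<beta>, \<gamma>]"
      by (auto simp: length_Suc_conv)
    have abc: "\<alpha> \<in> E" "\<beta> \<in> E" "\<gamma> \<in> E"
      using ks(3) k by auto
    have kc: "\<alpha> \<in> carrier K" "\<beta> \<in> carrier K" "\<gamma> \<in> carrier K"
      using abc assms(6) K by auto
    have rel: "\<alpha> \<oplus> \<beta> \<otimes> m \<oplus> \<gamma> \<otimes> c = \<zero>"
      using ks(2) k kc car by (simp add: a_assoc)
    \<comment> \<open>Substituting c = y - m x into the relation over E eliminates c and leaves
      \<delta> as the coefficient of m.\<close>
    define \<delta> where "\<delta> = \<beta> \<oplus> \<ominus> (\<gamma> \<otimes> x)"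
    have ELb: "\<alpha> \<in> Lb" "\<beta> \<in> Lb" "\<gamma> \<in> Lb" and xy: "x \<in> Lb" "y \<in> Lb"
      using abc assms(7,10) by auto
    have \<delta>: "\<delta> \<in> Lb" "\<delta> \<in> carrier K"
      using Lb(7)[OF ELb(2) Lb(5)[OF Lb(6)[OF ELb(3) xy(1)]]] K unfolding \<delta>_def by auto
    have "\<delta> \<otimes> m = (\<alpha> \<oplus> \<beta> \<otimes> m \<oplus> \<gamma> \<otimes> c) \<oplus> \<ominus> (\<alpha> \<oplus> \<gamma> \<otimes> y)"
      unfolding \<delta>_def assms(11) using kc car by algebra
    then have "\<delta> \<otimes> m = \<ominus> (\<alpha> \<oplus> \<gamma> \<otimes> y)"
      using rel kc car by simp
    moreover have "\<ominus> (\<alpha> \<oplus> \<gamma> \<otimes> y) \<in> Lb"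
      using Lb(5)[OF Lb(7)[OF ELb(1) Lb(6)[OF ELb(3) xy(2)]]] .
    \<comment> \<open>Otherwise m would be a quotient of elements of \<open>Lb\<close>.\<close>
    ultimately have "\<delta> = \<zero>"
      using subfield_m_inv_simprule[OF assms(3), of \<delta> m] \<delta> assms(13) car by auto
    have "\<beta> = \<delta> \<oplus> \<gamma> \<otimes> x"
      unfolding \<delta>_def using kc car by algebra
    with \<open>\<delta> = \<zero>\<close> have \<beta>: "\<beta> = \<gamma> \<otimes> x"
      using kc car by simp
    \<comment> \<open>Otherwise x would be the quotient of \<beta> by \<gamma>, an element of E and
      so of \<open>La\<close>.\<close>
    have "\<gamma> = \<zero>"
      using subfield_m_inv_simprule[OF assms(2), of \<gamma> x] abc assms(6,12) car \<beta> by auto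
    then show False
      using \<beta> rel kc car ks(4) k by simp
  qed
  ultimately show ?thesis
    using us(1) by blast
qed

lemma fixed_consts_closed:
  assumes "u \<in> fixed_consts" "v \<in> fixed_consts"
  shows "u \<otimes> v \<in> fixed_consts" "u \<oplus> v \<in> fixed_consts"
  using assms unfolding fixed_consts_def by (auto simp: der_add der_mult)

text \<open>If m were algebraic over x and y, exchange would make y algebraic over m and x, hence
  also c = y - m x; exchanging c with x would make x algebraic over m and c, against its
  choice.\<close>

lemma slope_not_mem_acl:
  assumes B: "B \<subseteq> carrier K" and F: "m \<in> fixed_consts" "c \<in> fixed_consts" "x \<in> fixed_consts"
    and "m \<notin> acl K B" "c \<notin> acl K (insert m B)" "x \<notin> acl K (insert m (insert c B))"
  shows "m \<notin> acl K (insert x (insert (m \<otimes> x \<oplus> c) B))"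
proof
  let ?y = "m \<otimes> x \<oplus> c"
  have car: "m \<in> carrier K" "c \<in> carrier K" "x \<in> carrier K"
    using F unfolding fixed_consts_def by auto
  have ins: "insert m (insert c B) \<subseteq> carrier K" "insert x B \<subseteq> carrier K" "insert m B \<subseteq> carrier K"
    "insert m (insert x B) \<subseteq> carrier K"
    using car B by auto
  \<comment> \<open>By exchange, since x is not algebraic over m.\<close>
  have "m \<notin> acl K (insert x B)"
    using acl_exchange[OF B F(3,1) _ assms(5)] assms(7) acl_mono[OF ins(1), of "insert m B"] by blast
  assume "m \<in> acl K (insert x (insert ?y B))"
  then have "m \<in> acl K (insert ?y (insert x B))"
    by (simp add: insert_commute)
  then have y: "?y \<in> acl K (insert m (insert x B))"
    using acl_exchange[OF ins(2) _ F(1) _ \<open>m \<notin> acl K (insert x B)\<close>]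
      fixed_consts_closed(2)[OF fixed_consts_closed(1)[OF F(1,3)] F(2)] by blast
  note S = subringE[OF subfieldE(1)[OF subfield_acl[OF ins(4)]]]
  have mx: "m \<in> acl K (insert m (insert x B))" "x \<in> acl K (insert m (insert x B))"
    using subset_acl[OF ins(4)] by auto
  have "?y \<oplus> \<ominus> (m \<otimes> x) \<in> acl K (insert m (insert x B))"
    using S(7)[OF y S(5)[OF S(6)[OF mx]]] .
  moreover have "?y \<oplus> \<ominus> (m \<otimes> x) = c"
    using car by algebra
  ultimately have "c \<in> acl K (insert x (insert m B))"
    by (simp add: insert_commute)
  then have "x \<in> acl K (insert c (insert m B))"
    using acl_exchange[OF ins(3) F(3,2) _ assms(6)] by blast
  then show False
    using assms(7) by (simp add: insert_commute)
qed

lemma infinite_subgroup_obtains_nonzero: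
  assumes "subgroup H (Ga_pow K n)" "infinite H"
  obtains h j where "h \<in> H" "j < n" "h j \<noteq> \<zero>"
proof -
  have "H \<subseteq> {\<lambda>j\<in>{..<n}. \<zero>}" if "\<And>h j. h \<in> H \<Longrightarrow> j < n \<Longrightarrow> h j = \<zero>"
    using subgroup.subset[OF assms(1)] that by (auto simp: fun_eq_iff PiE_def extensional_def)
  then show thesis
    using that assms(2) finite_subset by blast
qed

lemma infinite_definable_subgroup_not_one_based:
  assumes "saturated K" "A \<subseteq> carrier K" "A \<prec> carrier K" "definable K A n H"
    and H: "subgroup H (Ga_pow K n)" and "infinite H"
  shows "\<not> one_based K A n H"
proof
  assume one_based: "one_based K A n H"
  obtain h j where h: "h \<in> H" "j < n" "h j \<noteq> \<zero>"
    using infinite_subgroup_obtains_nonzero[OF H assms(6)] .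
  have n: "n > 0"
    using h(2) by simp
  have hK: "h i \<in> carrier K" if "i < n" for i
    using subgroup.subset[OF H] h(1) that by (auto simp: PiE_def Pi_def)
  let ?hs = "h ` {..<n}"
  let ?B = "A \<union> ?hs"
  have hs: "finite ?hs" "?hs \<subseteq> carrier K" and B: "?B \<subseteq> carrier K"
    using hK assms(2) by auto
  note generic = exists_generic_multiplier[OF assms(1-4) H n]
  obtain m where m: "m \<in> fixed_consts" "scale K n m h \<in> H" "m \<notin> acl K (A \<union> ?hs)"
    using generic[of "{h}" ?hs] h(1) hs by auto
  have mK: "m \<in> carrier K"
    using m(1) unfolding fixed_consts_def by blast
  obtain c where c: "c \<in> fixed_consts" "scale K n c h \<in> H" "c \<notin> acl K (A \<union> insert m ?hs)"
    using generic[of "{h}" "insert m ?hs"] h(1) hs mK by auto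
  have cK: "c \<in> carrier K"
    using c(1) unfolding fixed_consts_def by blast
  obtain x where x: "x \<in> fixed_consts" "\<forall>h' \<in> {h, scale K n m h}. scale K n x h' \<in> H"
      "x \<notin> acl K (A \<union> insert m (insert c ?hs))"
    by (rule generic[of "{h, scale K n m h}" "insert m (insert c ?hs)"])
       (use h(1) m(2) hs mK cK in auto)
  have xK: "x \<in> carrier K"
    using x(1) unfolding fixed_consts_def by blast
  define y where "y = m \<otimes> x \<oplus> c"
  have yK: "y \<in> carrier K"
    unfolding y_def using mK cK xK by simp
  \<comment> \<open>H is closed under addition but perhaps not under multiplication by x, so x was
    chosen to send the vector \<open>scale K n m h\<close> into H as well.\<close>
  have "scale K n y h = scale K n x (scale K n m h) \<otimes>\<^bsub>Ga_pow K n\<^esub> scale K n c h"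
    unfolding y_def scale_def mult_product_group
    by (rule restrict_ext) (simp add: hK mK cK xK l_distr r_distr m_ac)
  then have yH: "scale K n y h \<in> H"
    using subgroup.m_closed[OF H _ c(2)] x(2) by simp
  let ?a = "scaled_triple K n h m c" and ?b = "scaled_triple K n h x y"
  let ?ca = "coords n 3 ?a" and ?cb = "coords n 3 ?b"
  let ?La = "acl K (A \<union> ?ca)" and ?Lb = "acl K (A \<union> ?cb)"
  have caK: "A \<union> ?ca \<subseteq> carrier K" and cbK: "A \<union> ?cb \<subseteq> carrier K"
    unfolding coords_scaled_triple using assms(2) hK mK cK xK yK by auto
  \<comment> \<open>The base over which \<open>one_based\<close> asserts independence. It contains
    A, so the parameters need not be listed again next to \<open>?ca\<close> or
    \<open>?cb\<close>.\<close>
  define E where "E = ?La \<inter> ?Lb"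
  have EK: "E \<subseteq> carrier K"
    unfolding E_def using acl_carrier by blast
  have "x \<notin> ?La"
    using coords_scaled_triple_subset_acl[OF assms(2) hs(2) mK cK] x(3) by auto
  moreover have "m \<notin> ?Lb"
    using coords_scaled_triple_subset_acl[OF assms(2) hs(2) xK yK]
      slope_not_mem_acl[OF B m(1) c(1) x(1)] m(3) c(3) x(3) unfolding y_def by auto
  moreover have "x \<in> ?Lb" "y \<in> ?Lb"
    using multipliers_mem_acl[where h = h, OF cbK xK yK _ h(2,3)] by auto
  moreover have "?ca \<union> E \<subseteq> carrier K" "?cb \<union> E \<subseteq> carrier K"
    using caK cbK EK by auto
  moreover from this have "m \<in> acl K (?ca \<union> E)" "c \<in> acl K (?ca \<union> E)" "x \<in> acl K (?cb \<union> E)" "y \<in> acl K (?cb \<union> E)"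
    using multipliers_mem_acl[where h = h, OF _ mK cK _ h(2,3)]
      multipliers_mem_acl[where h = h, OF _ xK yK _ h(2,3)] by auto
  \<comment> \<open>Both fields are closed under \<open>acl\<close>, so enlarging E to
    \<open>acl K E\<close> stays inside each of them; a relation over \<open>acl K E\<close> is thus
    one over \<open>?La\<close> and over \<open>?Lb\<close>.\<close>
  moreover have "acl K E \<subseteq> ?La" "acl K E \<subseteq> ?Lb"
    using acl_minimal[OF caK, of E] acl_minimal[OF cbK, of E] unfolding E_def by auto
  ultimately have "\<exists>us. set us \<subseteq> acl K (?ca \<union> E) \<and> independent (acl K E) us \<and> \<not> independent (acl K (?cb \<union> E)) us"
    using line_relation_not_linearly_disjoint[of "acl K E" ?La ?Lb "acl K (?cb \<union> E)" "acl K (?ca \<union> E)" m c x y]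
      subfield_acl[OF EK] subfield_acl[OF caK] subfield_acl[OF cbK] subfield_acl y_def by simp
  moreover have "indep_over K E ?ca ?cb"
    using one_based scaled_triple_PiE[OF h(1) m(2) c(2)] scaled_triple_PiE[OF h(1) _ yH] x(2)
    unfolding one_based_def E_def by blast
  ultimately show False
    unfolding indep_over_def linearly_disjoint_def by blast
qed

end

theorem proposition4p2p1:
  fixes U :: "'a dd_ring" and n :: nat and A :: "'a set" and H :: "(nat \<Rightarrow> 'a) set"
  assumes "DCFA_model U" and "saturated U"
    and "n \<ge> 1"
    and "A \<subseteq> carrier U" and "A \<prec> carrier U"
    and "definable U A n H"
    and "subgroup H (Ga_pow U n)"
    and "infinite H"
  shows "\<not> one_based U A n H"
proof -
  interpret dd_field U
    using assms(1) unfolding DCFA_model_def by blast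
  show ?thesis
    using infinite_definable_subgroup_not_one_based[OF assms(2,4-8)] .
qed

end
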